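(* Equip the five dimensional affine space $\mathrm{iss}_2(\mathbb{C}\langle x,x^*\rangle)$ with the Poisson structure induced by the necklace Lie algebra. Its symplectic leaves correspond to the coadjoint orbits of $\mathfrak{sl}_2$ (the leaves being the preimages of the coadjoint orbits under the map $\mathrm{iss}_2(\mathbb{C}\langle x,x^*\rangle)\to\mathfrak{sl}_2^*$ given by the coordinate functions $(E',F',H')$), and hence they are the level sets $$\mathcal{S}_\lambda=\{\rho\in\mathrm{iss}_2(\mathbb{C}\langle x,x^*\rangle)\mid c_{\mathfrak{sl}_2}(\rho)=\lambda\},\qquad\lambda\in\mathbb{C}^*,$$ of the Casimir element $c_{\mathfrak{sl}_2}$, together with the two sets $$\mathcal{S}_0'=\{\rho\in\mathrm{iss}_2(\mathbb{C}\langle x,x^*\rangle)\mid c_{\mathfrak{sl}_2}(\rho)=0,\ (E',F',H')(\rho)\ne0\}$$ and $$\mathcal{S}_0''=\{\rho\in\mathrm{iss}_2(\mathbb{C}\langle x,x^*\rangle)\mid (E',F',H')(\rho)=0\}.$$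
   Context: Let $A=\mathbb{C}\langle x,x^*\rangle$. $\mathrm{iss}_2(A)$ is the quotient variety of $\mathrm{rep}_2(A)=M_2(\mathbb{C})^{\oplus2}$ by simultaneous conjugation by $\mathrm{GL}_2(\mathbb{C})$; its coordinate ring $\mathbb{C}[\mathrm{iss}_2(A)]$ is the polynomial algebra on $tr(x),tr(x^* ),tr(x^2),tr((x^* )^2),tr(xx^* )$ (traces of words evaluated on two generic $2\times2$ matrices), so $\mathrm{iss}_2(A)\cong\mathbb{C}^5$. The canonical symplectic double bracket on $A$ is the bilinear map $\{\!\{-,-\}\!\}:A\otimes A\to A\otimes A$ determined by $\{\!\{x,x\}\!\}=\{\!\{x^*,x^*\}\!\}=0$, $\{\!\{x,x^*\}\!\}=1\otimes1$, together with $\{\!\{a,b\}\!\}=-\{\!\{b,a\}\!\}^{o}$ (where $(u\otimes v)^o=v\otimes u$) and $\{\!\{a,bc\}\!\}=b\{\!\{a,c\}\!\}+\{\!\{a,b\}\!\}c$ for the outer bimodule structure $a(u\otimes v)c=(au)\otimes(vc)$. With $\mu$ the multiplication of $A$, the map $(a,b)\mapsto\mu(\{\!\{a,b\}\!\})$ induces a Lie bracket $\{-,-\}$ on the necklace Lie algebra $\mathfrak{n}=A/[A,A]$ ($[A,A]$ = span of commutators). The induced Poisson bracket on $\mathbb{C}[\mathrm{iss}_2(A)]$ is characterized by $\{tr(w_1),tr(w_2)\}=tr(\{w_1,w_2\})$. Put $H=tr(xx^* )$, $F=-\frac{tr(x^2)}2$, $E=\frac{tr((x^* )^2)}2$, $X=tr(x^*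 )$, $Y=-tr(x)$, and $$H'=H+\frac{XY}2,\qquad E'=E-\frac{X^2}4,\qquad F'=F+\frac{Y^2}4 .$$ These satisfy $\{H',E'\}=2E'$, $\{H',F'\}=-2F'$, $\{E',F'\}=H'$, so they generate a Poisson subalgebra identified with $S(\mathfrak{sl}_2)=\mathbb{C}[\mathfrak{sl}_2^*]$. The Casimir element is $c_{\mathfrak{sl}_2}=H'^2+4E'F'$. *)

theory Defs
  imports "HOL-Analysis.Analysis" "HOL-Library.Poly_Mapping"
begin

section \<open>Linear algebra of finitely supported functions\<close>

definition scal :: "complex \<Rightarrow> ('k \<Rightarrow>\<^sub>0 complex) \<Rightarrow> ('k \<Rightarrow>\<^sub>0 complex)" where
  "scal c t = Poly_Mapping.map ((*) c) t"

lemma lookup_scal [simp]: "Poly_Mapping.lookup (scal c t) k = c * Poly_Mapping.lookup t k"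
  by (simp add: scal_def Poly_Mapping.map.rep_eq when_def)

global_interpretation pm: vector_space "scal :: complex \<Rightarrow> ('k \<Rightarrow>\<^sub>0 complex) \<Rightarrow> _"
  by unfold_locales (auto intro!: poly_mapping_eqI simp: lookup_add algebra_simps)

abbreviation linear_pm :: "(('k \<Rightarrow>\<^sub>0 complex) \<Rightarrow> ('l \<Rightarrow>\<^sub>0 complex)) \<Rightarrow> bool" where
  "linear_pm \<equiv> Vector_Spaces.linear scal scal"

abbreviation basis :: "'k \<Rightarrow> ('k \<Rightarrow>\<^sub>0 complex)" where
  "basis k \<equiv> Poly_Mapping.single k 1"

definition lin_ext :: "('k \<Rightarrow> ('l \<Rightarrow>\<^sub>0 complex)) \<Rightarrow> ('k \<Rightarrow>\<^sub>0 complex) \<Rightarrow> ('l \<Rightarrow>\<^sub>0 complex)" where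
  "lin_ext \<phi> a = (\<Sum>k\<in>Poly_Mapping.keys a. scal (Poly_Mapping.lookup a k) (\<phi> k))"

lemma linear_pmI:
  assumes "\<And>x y. f (x + y) = f x + f y" "\<And>c x. f (scal c x) = scal c (f x)"
  shows "linear_pm f"
  using assms by unfold_locales auto

lemma linear_pmD:
  assumes "linear_pm f"
  shows "f (x + y) = f x + f y" "f (scal c x) = scal c (f x)" "f (x - y) = f x - f y"
    "f (- x) = - f x" "f 0 = 0" "f (sum g S) = (\<Sum>s\<in>S. f (g s))"
  using assms by (auto simp: linear_iff_module_hom module_hom.add module_hom.scale
      module_hom.diff module_hom.neg module_hom.zero module_hom.sum)

lemma single_scal: "Poly_Mapping.single k c = scal c (basis k)"
  by (rule poly_mapping_eqI) (simp add: lookup_single when_def)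

lemma pm_expand: "a = (\<Sum>k\<in>Poly_Mapping.keys a. scal (Poly_Mapping.lookup a k) (basis k))"
  by (rule poly_mapping_eqI)
    (auto simp: lookup_sum lookup_single when_def if_distrib sum.delta in_keys_iff cong: if_cong)

lemma linear_pm_eqI:
  assumes "linear_pm f" "linear_pm g" "\<And>k. f (basis k) = g (basis k)"
  shows "f a = g a"
proof -
  let ?s = "\<Sum>k\<in>Poly_Mapping.keys a. scal (Poly_Mapping.lookup a k) (basis k)"
  have "f ?s = g ?s" by (simp add: linear_pmD[OF assms(1)] linear_pmD[OF assms(2)] assms(3))
  thus ?thesis by (simp flip: pm_expand)
qed

lemma lin_ext_superset:
  assumes "finite S" "Poly_Mapping.keys a \<subseteq> S"
  shows "lin_ext \<phi> a = (\<Sum>k\<in>S. scal (Poly_Mapping.lookup a k) (\<phi> k))"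
  unfolding lin_ext_def using assms
  by (intro sum.mono_neutral_left) (auto simp: in_keys_iff)

lemma linear_lin_ext: "linear_pm (lin_ext \<phi>)"
proof (rule linear_pmI)
  fix x y :: "'a \<Rightarrow>\<^sub>0 complex"
  let ?S = "Poly_Mapping.keys x \<union> Poly_Mapping.keys y"
  have "Poly_Mapping.keys (x + y) \<subseteq> ?S" by (rule Poly_Mapping.keys_add)
  thus "lin_ext \<phi> (x + y) = lin_ext \<phi> x + lin_ext \<phi> y"
    by (simp add: lin_ext_superset[where S="?S"] lookup_add pm.scale_left_distrib sum.distrib)
next
  fix c and x :: "'a \<Rightarrow>\<^sub>0 complex"
  have "Poly_Mapping.keys (scal c x) \<subseteq> Poly_Mapping.keys x" by (auto simp: in_keys_iff)
  thus "lin_ext \<phi> (scal c x) = scal c (lin_ext \<phi> x)"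
    by (simp add: lin_ext_superset[where S="Poly_Mapping.keys x"] pm.scale_sum_right)
qed

lemma lin_ext_basis [simp]: "lin_ext \<phi> (basis k) = \<phi> k"
  by (simp add: lin_ext_def)

section \<open>The free algebra on two generators and its tensor square\<close>

datatype letter = Ltr_x | Ltr_xs

datatype word = Word (letters: "letter list")

instantiation word :: monoid_add
begin
definition zero_word :: word where "0 = Word []"
definition plus_word :: "word \<Rightarrow> word \<Rightarrow> word" where "u + v = Word (letters u @ letters v)"
instance by standard (auto simp: zero_word_def plus_word_def)
end

text \<open>Words form a monoid under concatenation (written additively, as required by the convolution
  product on \<open>\<Rightarrow>\<^sub>0\<close>), so \<open>alg\<close> is the monoid algebra of the free monoid, i.e. the free algebra
  on \<open>x, x*\<close>, and \<open>alg2\<close> is the algebra structure on its tensor square.\<close>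

type_synonym alg = "word \<Rightarrow>\<^sub>0 complex"
type_synonym alg2 = "(word \<times> word) \<Rightarrow>\<^sub>0 complex"

definition gx :: alg where "gx = basis (Word [Ltr_x])"
definition gxs :: alg where "gxs = basis (Word [Ltr_xs])"

definition tensor :: "alg \<Rightarrow> alg \<Rightarrow> alg2" where
  "tensor a b = (\<Sum>u\<in>Poly_Mapping.keys a. \<Sum>v\<in>Poly_Mapping.keys b.
     Poly_Mapping.single (u, v) (Poly_Mapping.lookup a u * Poly_Mapping.lookup b v))"

definition tensor_op :: "alg2 \<Rightarrow> alg2" where
  "tensor_op = lin_ext (\<lambda>(u, v). basis (v, u))"

definition mu :: "alg2 \<Rightarrow> alg" where
  "mu = lin_ext (\<lambda>(u, v). basis (u + v))"

definition outer :: "alg \<Rightarrow> alg2 \<Rightarrow> alg \<Rightarrow> alg2" where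
  "outer a t c = tensor a 1 * t * tensor 1 c"

lemma lookup_tensor:
  "Poly_Mapping.lookup (tensor a b) (u, v) = Poly_Mapping.lookup a u * Poly_Mapping.lookup b v"
proof -
  have "Poly_Mapping.lookup (tensor a b) (u, v) =
     (\<Sum>u'\<in>Poly_Mapping.keys a. \<Sum>v'\<in>Poly_Mapping.keys b.
        if v' = v then if u' = u then Poly_Mapping.lookup a u * Poly_Mapping.lookup b v else 0 else 0)"
    unfolding tensor_def lookup_sum
    by (intro sum.cong refl) (auto simp: lookup_single when_def)
  also have "\<dots> = Poly_Mapping.lookup a u * Poly_Mapping.lookup b v"
    by (cases "Poly_Mapping.lookup b v = 0"; cases "Poly_Mapping.lookup a u = 0")
      (simp_all add: sum.delta in_keys_iff)
  finally show ?thesis .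
qed

lemma tensor_bilinear: "linear_pm (tensor a)" "linear_pm (\<lambda>a. tensor a b)"
  by (auto intro!: linear_pmI poly_mapping_eqI simp: lookup_tensor lookup_add algebra_simps)

lemma tensor_basis: "tensor (basis u) (basis v) = basis (u, v)"
  by (auto intro!: poly_mapping_eqI simp: lookup_tensor lookup_single when_def)

lemma one_basis: "(1 :: 'k::monoid_add \<Rightarrow>\<^sub>0 complex) = basis 0"
  by simp

lemma scal_single: "scal c (Poly_Mapping.single k d) = Poly_Mapping.single k (c * d)"
  by (rule poly_mapping_eqI) (simp add: lookup_single when_def)

lemma pm_expand_single: "a = (\<Sum>k\<in>Poly_Mapping.keys a. Poly_Mapping.single k (Poly_Mapping.lookup a k))"
  for a :: "'k \<Rightarrow>\<^sub>0 complex"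
  using pm_expand[of a] by (simp only: scal_single mult_1_right)

lemma scal_mult:
  fixes a b :: "'k::monoid_add \<Rightarrow>\<^sub>0 complex"
  shows "scal c a * b = scal c (a * b)" "a * scal c b = scal c (a * b)"
proof -
  let ?A = "\<Sum>k\<in>Poly_Mapping.keys a. Poly_Mapping.single k (Poly_Mapping.lookup a k)"
  let ?B = "\<Sum>k\<in>Poly_Mapping.keys b. Poly_Mapping.single k (Poly_Mapping.lookup b k)"
  have "scal c ?A * ?B = scal c (?A * ?B)" "?A * scal c ?B = scal c (?A * ?B)"
    by (simp_all only: pm.scale_sum_right scal_single sum_product mult_single mult.assoc mult.left_commute)
  thus "scal c a * b = scal c (a * b)" "a * scal c b = scal c (a * b)"
    by (simp_all flip: pm_expand_single)
qed

lemma linear_mult: "linear_pm (\<lambda>b. a * b)" "linear_pm (\<lambda>a. a * b)"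
  for a b :: "'k::monoid_add \<Rightarrow>\<^sub>0 complex"
  by (auto intro!: linear_pmI simp: scal_mult distrib_left distrib_right)

lemma linear_outer: "linear_pm (\<lambda>t. outer a t c)" "linear_pm (\<lambda>a. outer a t c)"
    "linear_pm (\<lambda>c. outer a t c)"
  unfolding outer_def
  by (auto intro!: linear_pmI simp: scal_mult distrib_left distrib_right linear_pmD[OF tensor_bilinear(1)]
      linear_pmD[OF tensor_bilinear(2)])

lemma outer_basis:
  "outer (basis a) (basis (u, v)) (basis c) = basis (a + u, v + c)"
  unfolding outer_def one_basis tensor_basis by (simp add: mult_single)

lemma outer_tensor: "outer a (tensor u v) c = tensor (a * u) (v * c)"
proof -
  note lins = linear_pmD(1,2)[OF tensor_bilinear(1)] linear_pmD(1,2)[OF tensor_bilinear(2)]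
    linear_pmD(1,2)[OF linear_outer(1)] linear_pmD(1,2)[OF linear_outer(2)]
    linear_pmD(1,2)[OF linear_outer(3)] scal_mult distrib_left distrib_right
  have 1: "outer (basis a') (tensor (basis u') (basis v')) (basis c') =
     tensor (basis a' * basis u') (basis v' * basis c')" for a' u' v' c'
    by (simp add: mult_single tensor_basis outer_basis)
  have 2: "outer a (tensor (basis u') (basis v')) (basis c') =
     tensor (a * basis u') (basis v' * basis c')" for u' v' c'
    by (rule linear_pm_eqI[of "\<lambda>a. outer a (tensor (basis u') (basis v')) (basis c')"
          "\<lambda>a. tensor (a * basis u') (basis v' * basis c')"])
      ((rule linear_pmI; simp add: lins)+, rule 1)
  have 3: "outer a (tensor u (basis v')) (basis c') = tensor (a * u) (basis v' * basis c')" for v' c'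
    by (rule linear_pm_eqI[of "\<lambda>u. outer a (tensor u (basis v')) (basis c')"
          "\<lambda>u. tensor (a * u) (basis v' * basis c')"])
      ((rule linear_pmI; simp add: lins)+, rule 2)
  have 4: "outer a (tensor u v) (basis c') = tensor (a * u) (v * basis c')" for c'
    by (rule linear_pm_eqI[of "\<lambda>v. outer a (tensor u v) (basis c')"
          "\<lambda>v. tensor (a * u) (v * basis c')"])
      ((rule linear_pmI; simp add: lins)+, rule 3)
  show ?thesis
    by (rule linear_pm_eqI[of "\<lambda>c. outer a (tensor u v) c" "\<lambda>c. tensor (a * u) (v * c)"])
      ((rule linear_pmI; simp add: lins)+, rule 4)
qed

lemma linear_mu: "linear_pm mu" and linear_tensor_op: "linear_pm tensor_op"
  unfolding mu_def tensor_op_def by (rule linear_lin_ext)+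

lemma mu_basis [simp]: "mu (basis (u, v)) = basis (u + v)"
  and tensor_op_basis [simp]: "tensor_op (basis (u, v)) = basis (v, u)"
  by (simp_all add: mu_def tensor_op_def)

section \<open>The canonical double bracket\<close>

definition canonical_double_bracket :: "(alg \<Rightarrow> alg \<Rightarrow> alg2) \<Rightarrow> bool" where
  "canonical_double_bracket D \<longleftrightarrow>
     (\<forall>a. linear_pm (D a)) \<and> (\<forall>b. linear_pm (\<lambda>a. D a b)) \<and>
     D gx gx = 0 \<and> D gxs gxs = 0 \<and> D gx gxs = tensor 1 1 \<and>
     (\<forall>a b. D a b = - tensor_op (D b a)) \<and>
     (\<forall>a b c. D a (b * c) = outer b (D a c) 1 + outer 1 (D a b) c)"

definition letter_form :: "letter \<Rightarrow> letter \<Rightarrow> complex" where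
  "letter_form a b = (if a = Ltr_x \<and> b = Ltr_xs then 1 else if a = Ltr_xs \<and> b = Ltr_x then -1 else 0)"

definition word_bracket :: "letter list \<Rightarrow> letter list \<Rightarrow> alg2" where
  "word_bracket u v = (\<Sum>i<length u. \<Sum>j<length v. scal (letter_form (u ! i) (v ! j))
     (basis (Word (take j v @ drop (Suc i) u), Word (take i u @ drop (Suc j) v))))"

lemma word_bracket_antisym: "word_bracket u v = - tensor_op (word_bracket v u)"
proof -
  have "- tensor_op (word_bracket v u) = (\<Sum>j<length v. \<Sum>i<length u. scal (letter_form (u ! i) (v ! j))
     (basis (Word (take j v @ drop (Suc i) u), Word (take i u @ drop (Suc j) v))))"
    by (auto simp: word_bracket_def linear_pmD[OF linear_tensor_op] letter_form_def
        simp flip: sum_negf intro!: sum.cong)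
  also have "\<dots> = word_bracket u v"
    unfolding word_bracket_def by (rule sum.swap)
  finally show ?thesis ..
qed

lemma sum_lessThan_add: "(\<Sum>i<m + n. f i) = (\<Sum>i<m. f i) + (\<Sum>i<n. f (m + i))"
  for f :: "nat \<Rightarrow> 'a::comm_monoid_add"
  by (induction n) (auto simp: add.assoc)

lemma word_bracket_deriv:
  "word_bracket u (v @ w) =
     outer (basis (Word v)) (word_bracket u w) 1 + outer 1 (word_bracket u v) (basis (Word w))"
proof -
  let ?t = "\<lambda>i j. scal (letter_form (u ! i) ((v @ w) ! j))
     (basis (Word (take j (v @ w) @ drop (Suc i) u), Word (take i u @ drop (Suc j) (v @ w)))) :: alg2"
  have "?t i j = outer 1 (scal (letter_form (u ! i) (v ! j))
     (basis (Word (take j v @ drop (Suc i) u), Word (take i u @ drop (Suc j) v)))) (basis (Word w))"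
    if "j < length v" for i j
    unfolding one_basis linear_pmD(2)[OF linear_outer(1)] outer_basis using that
    by (simp add: nth_append plus_word_def zero_word_def)
  moreover have "?t i (length v + j) = outer (basis (Word v)) (scal (letter_form (u ! i) (w ! j))
     (basis (Word (take j w @ drop (Suc i) u), Word (take i u @ drop (Suc j) w)))) 1" for i j
    unfolding one_basis linear_pmD(2)[OF linear_outer(1)] outer_basis
    by (simp add: nth_append plus_word_def zero_word_def)
  ultimately show ?thesis
    unfolding word_bracket_def length_append sum_lessThan_add sum.distrib linear_pmD(6)[OF linear_outer(1)]
    by (simp add: add.commute)
qed

definition std_bracket :: "alg \<Rightarrow> alg \<Rightarrow> alg2" where
  "std_bracket a b = lin_ext (\<lambda>u. lin_ext (\<lambda>v. word_bracket (letters u) (letters v)) b) a"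

lemma std_bracket_linear: "linear_pm (\<lambda>a. std_bracket a b)" "linear_pm (std_bracket a)"
proof -
  show "linear_pm (\<lambda>a. std_bracket a b)" unfolding std_bracket_def by (rule linear_lin_ext)
  show "linear_pm (std_bracket a)"
    by (rule linear_pmI)
      (simp_all add: std_bracket_def lin_ext_def[of _ a] linear_pmD[OF linear_lin_ext]
        pm.scale_right_distrib sum.distrib pm.scale_sum_right mult.commute)
qed

lemma std_bracket_basis: "std_bracket (basis u) (basis v) = word_bracket (letters u) (letters v)"
  by (simp add: std_bracket_def)

lemma canonical_double_bracket_exists: "canonical_double_bracket std_bracket"
  unfolding canonical_double_bracket_def
proof (intro conjI allI)
  show "std_bracket gx gx = 0" "std_bracket gxs gxs = 0" "std_bracket gx gxs = tensor 1 1"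
    unfolding one_basis tensor_basis
    by (simp_all add: gx_def gxs_def std_bracket_basis word_bracket_def letter_form_def zero_word_def
        del: single_one)
  note lins = linear_pmD(1,2)[OF std_bracket_linear(1)] linear_pmD(1,2)[OF std_bracket_linear(2)]
    linear_pmD(1,2)[OF linear_tensor_op] linear_pmD(1,2)[OF linear_outer(1)]
    linear_pmD(1,2)[OF linear_outer(2)] linear_pmD(1,2)[OF linear_outer(3)]
    scal_mult distrib_left distrib_right pm.scale_right_distrib
  show "std_bracket a b = - tensor_op (std_bracket b a)" for a b
  proof (rule linear_pm_eqI[of "\<lambda>a. std_bracket a b" "\<lambda>a. - tensor_op (std_bracket b a)"])
    show "std_bracket (basis u) b = - tensor_op (std_bracket b (basis u))" for u
    proof (rule linear_pm_eqI[of "std_bracket (basis u)" "\<lambda>b. - tensor_op (std_bracket b (basis u))"])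
      show "std_bracket (basis u) (basis v) = - tensor_op (std_bracket (basis v) (basis u))" for v
        unfolding std_bracket_basis by (rule word_bracket_antisym)
    qed (rule linear_pmI; simp add: lins)+
  qed (rule linear_pmI; simp add: lins)+
  have bb: "std_bracket (basis u) (basis v * basis w) =
      outer (basis v) (std_bracket (basis u) (basis w)) 1 + outer 1 (std_bracket (basis u) (basis v)) (basis w)"
    for u v w
    using word_bracket_deriv[of "letters u" "letters v" "letters w"]
    by (simp add: mult_single std_bracket_basis plus_word_def)
  have b1: "std_bracket a (basis v * basis w) =
      outer (basis v) (std_bracket a (basis w)) 1 + outer 1 (std_bracket a (basis v)) (basis w)" for a v w
    by (rule linear_pm_eqI[of "\<lambda>a. std_bracket a (basis v * basis w)" "\<lambda>a.
          outer (basis v) (std_bracket a (basis w)) 1 + outer 1 (std_bracket a (basis v)) (basis w)"])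
      ((rule linear_pmI; simp add: lins)+, rule bb)
  have b2: "std_bracket a (b * basis w) =
      outer b (std_bracket a (basis w)) 1 + outer 1 (std_bracket a b) (basis w)" for a b w
    by (rule linear_pm_eqI[of "\<lambda>b. std_bracket a (b * basis w)" "\<lambda>b.
          outer b (std_bracket a (basis w)) 1 + outer 1 (std_bracket a b) (basis w)"])
      ((rule linear_pmI; simp add: lins)+, rule b1)
  show "std_bracket a (b * c) = outer b (std_bracket a c) 1 + outer 1 (std_bracket a b) c" for a b c
    by (rule linear_pm_eqI[of "\<lambda>c. std_bracket a (b * c)" "\<lambda>c.
          outer b (std_bracket a c) 1 + outer 1 (std_bracket a b) c"])
      ((rule linear_pmI; simp add: lins)+, rule b2)
qed (rule std_bracket_linear)+

lemma basis_Cons: "basis (Word (s # w)) = basis (Word [s]) * basis (Word w)"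
  by (simp add: mult_single plus_word_def)

lemma canonical_double_bracket_unique:
  assumes D: "canonical_double_bracket D" and D': "canonical_double_bracket D'"
  shows "D = D'"
proof -
  note d = D[unfolded canonical_double_bracket_def] D'[unfolded canonical_double_bracket_def]
  have lin: "linear_pm (D a)" "linear_pm (D' a)" "linear_pm (\<lambda>a. D a b)" "linear_pm (\<lambda>a. D' a b)" for a b
    using d by blast+
  have der: "D a (b * c) = outer b (D a c) 1 + outer 1 (D a b) c"
    "D' a (b * c) = outer b (D' a c) 1 + outer 1 (D' a b) c" for a b c
    using d by blast+
  have anti: "D a b = - tensor_op (D b a)" "D' a b = - tensor_op (D' b a)" for a b
    using d by blast+
  have "tensor 1 1 = 1"
    unfolding one_basis tensor_basis by (simp add: zero_prod_def del: single_one)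
  hence o1: "outer 1 t 1 = t" for t
    by (simp add: outer_def)
  have one: "D a 1 = 0" "D' a 1 = 0" for a
    using der(1)[of a 1 1] der(2)[of a 1 1] by (simp_all add: o1)
  have LL: "D (basis (Word [s])) (basis (Word [t])) = D' (basis (Word [s])) (basis (Word [t]))" for s t
  proof -
    have "D gx gx = 0" "D gxs gxs = 0" "D gx gxs = tensor 1 1"
      "D' gx gx = 0" "D' gxs gxs = 0" "D' gx gxs = tensor 1 1"
      using d by blast+
    moreover from this have "D gxs gx = D' gxs gx"
      by (simp only: anti(1)[of gxs gx] anti(2)[of gxs gx])
    ultimately show ?thesis
      by (cases s; cases t) (simp_all only: gx_def[symmetric] gxs_def[symmetric])
  qed
  have LW: "D a (basis (Word v)) = D' a (basis (Word v))"
    if "\<And>t. D a (basis (Word [t])) = D' a (basis (Word [t]))" for a v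
  proof (induction v)
    case Nil
    show ?case using one[of a] by (simp add: zero_word_def one_basis del: single_one)
  next
    case (Cons s v)
    show ?case unfolding basis_Cons[of s v] der Cons that ..
  qed
  have WL: "D (basis (Word u)) (basis (Word [t])) = D' (basis (Word u)) (basis (Word [t]))" for u t
    by (simp only: anti(1)[of "basis (Word u)"] anti(2)[of "basis (Word u)"] LW[OF LL, of t u])
  have WW: "D (basis u) (basis v) = D' (basis u) (basis v)" for u v
    using LW[OF WL, of "letters u" "letters v"] by simp
  have "D a (basis v) = D' a (basis v)" for a v
    by (rule linear_pm_eqI[OF lin(3,4) WW])
  hence "D a b = D' a b" for a b
    by (rule linear_pm_eqI[OF lin(1,2)])
  thus ?thesis by blast
qed

definition dbl :: "alg \<Rightarrow> alg \<Rightarrow> alg2" where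
  "dbl = (THE D. canonical_double_bracket D)"

lemma canonical_double_bracket_dbl: "canonical_double_bracket dbl"
  unfolding dbl_def
  by (rule theI[of _ std_bracket])
    (auto intro: canonical_double_bracket_exists canonical_double_bracket_unique)



section \<open>The necklace Lie algebra\<close>

definition commutator_space :: "alg set" where
  "commutator_space = pm.span {a * b - b * a | a b. True}"

lemma commutator_space_closed:
  "a * b - b * a \<in> commutator_space" "0 \<in> commutator_space"
  "s \<in> commutator_space \<Longrightarrow> t \<in> commutator_space \<Longrightarrow> s + t \<in> commutator_space"
  "s \<in> commutator_space \<Longrightarrow> t \<in> commutator_space \<Longrightarrow> s - t \<in> commutator_space"
  "s \<in> commutator_space \<Longrightarrow> - s \<in> commutator_space"
  "s \<in> commutator_space \<Longrightarrow> scal c s \<in> commutator_space"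
  unfolding commutator_space_def
  by (auto intro: pm.span_base pm.span_zero pm.span_add pm.span_diff pm.span_neg pm.span_scale)

quotient_type necklace = alg / "\<lambda>a b. a - b \<in> commutator_space"
proof (rule equivpI)
  show "reflp (\<lambda>a b. a - b \<in> commutator_space)"
    by (rule reflpI) (simp add: commutator_space_closed)
  show "symp (\<lambda>a b. a - b \<in> commutator_space)"
    by (rule sympI) (metis commutator_space_closed(5) minus_diff_eq)
  show "transp (\<lambda>a b. a - b \<in> commutator_space)"
    by (rule transpI) (metis commutator_space_closed(3) add_diff_eq diff_add_cancel)
qed

lemma mu_outer: "mu (outer b t 1) = b * mu t" "mu (outer 1 t c) = mu t * c"
proof -
  note lins = linear_pmD(1,2)[OF linear_mu] linear_pmD(1,2)[OF linear_outer(1)]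
    linear_pmD(1,2)[OF linear_outer(2)] linear_pmD(1,2)[OF linear_outer(3)]
    scal_mult distrib_left distrib_right
  have 1: "mu (outer (basis u) (basis k) 1) = basis u * mu (basis k)"
    "mu (outer 1 (basis k) (basis u)) = mu (basis k) * basis u" for u k
    unfolding one_basis by (cases k; simp add: outer_basis mult_single add.assoc del: single_one)+
  have 2: "mu (outer b (basis k) 1) = b * mu (basis k)" for k
    by (rule linear_pm_eqI[of "\<lambda>b. mu (outer b (basis k) 1)" "\<lambda>b. b * mu (basis k)"])
      ((rule linear_pmI; simp add: lins)+, rule 1)
  have 3: "mu (outer 1 (basis k) c) = mu (basis k) * c" for k
    by (rule linear_pm_eqI[of "\<lambda>c. mu (outer 1 (basis k) c)" "\<lambda>c. mu (basis k) * c"])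
      ((rule linear_pmI; simp add: lins)+, rule 1)
  show "mu (outer b t 1) = b * mu t"
    by (rule linear_pm_eqI[of "\<lambda>t. mu (outer b t 1)" "\<lambda>t. b * mu t"])
      ((rule linear_pmI; simp add: lins)+, rule 2)
  show "mu (outer 1 t c) = mu t * c"
    by (rule linear_pm_eqI[of "\<lambda>t. mu (outer 1 t c)" "\<lambda>t. mu t * c"])
      ((rule linear_pmI; simp add: lins)+, rule 3)
qed

lemma mu_tensor_op: "mu (tensor_op t) - mu t \<in> commutator_space"
proof -
  let ?s = "\<Sum>k\<in>Poly_Mapping.keys t. scal (Poly_Mapping.lookup t k) (basis k)"
  have "mu (tensor_op ?s) - mu ?s = (\<Sum>k\<in>Poly_Mapping.keys t.
      scal (Poly_Mapping.lookup t k) (mu (tensor_op (basis k)) - mu (basis k)))"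
    by (simp add: linear_pmD[OF linear_mu] linear_pmD[OF linear_tensor_op] sum_subtractf
        pm.scale_right_diff_distrib)
  also have "\<dots> \<in> commutator_space"
    unfolding commutator_space_def
  proof (intro pm.span_sum pm.span_scale pm.span_base)
    fix k :: "word \<times> word"
    obtain u v where k: "k = (u, v)" by (cases k)
    have "mu (tensor_op (basis k)) - mu (basis k) = basis v * basis u - basis u * basis v"
      by (simp add: k mult_single)
    thus "mu (tensor_op (basis k)) - mu (basis k) \<in> {a * b - b * a | a b. True}" by blast
  qed
  finally show ?thesis by (simp flip: pm_expand)
qed

lemma dbl_linear: "linear_pm (dbl a)" "linear_pm (\<lambda>a. dbl a b)"
  and dbl_antisym: "dbl a b = - tensor_op (dbl b a)"
  and dbl_deriv: "dbl a (b * c) = outer b (dbl a c) 1 + outer 1 (dbl a b) c"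
  using canonical_double_bracket_dbl unfolding canonical_double_bracket_def by blast+

lemma mu_dbl_commutator:
  assumes "s \<in> commutator_space"
  shows "mu (dbl a s) \<in> commutator_space" "mu (dbl s a) \<in> commutator_space"
proof -
  show *: "mu (dbl a s) \<in> commutator_space"
    using assms unfolding commutator_space_def
  proof (induction rule: pm.span_induct_alt)
    case base
    show ?case using pm.span_zero by (simp add: linear_pmD(5)[OF dbl_linear(1)] linear_pmD(5)[OF linear_mu])
  next
    case (step c x y)
    then obtain b d where x: "x = b * d - d * b" by blast
    have "mu (dbl a x) = (b * mu (dbl a d) - mu (dbl a d) * b) + (mu (dbl a b) * d - d * mu (dbl a b))"
      by (simp add: x linear_pmD(3)[OF dbl_linear(1)] dbl_deriv linear_pmD(1,3)[OF linear_mu] mu_outer)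
    also have "\<dots> \<in> commutator_space" by (intro commutator_space_closed)
    finally have "scal c (mu (dbl a x)) + mu (dbl a y) \<in> commutator_space"
      using step by (auto simp: commutator_space_def intro!: pm.span_add pm.span_scale)
    thus ?case
      by (simp add: linear_pmD(1,2)[OF dbl_linear(1)] linear_pmD(1,2)[OF linear_mu] commutator_space_def)
  qed
  have "mu (dbl s a) = - (mu (tensor_op (dbl a s)) - mu (dbl a s)) - mu (dbl a s)"
    by (simp add: dbl_antisym[of s a] linear_pmD(4)[OF linear_mu])
  also have "\<dots> \<in> commutator_space"
    by (intro commutator_space_closed mu_tensor_op *)
  finally show "mu (dbl s a) \<in> commutator_space" .
qed

lift_definition necklace_bracket :: "necklace \<Rightarrow> necklace \<Rightarrow> necklace" is "\<lambda>a b. mu (dbl a b)"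
proof -
  fix a a' b b' :: alg
  assume "a - a' \<in> commutator_space" "b - b' \<in> commutator_space"
  hence "mu (dbl (a - a') b) + mu (dbl a' (b - b')) \<in> commutator_space"
    by (intro commutator_space_closed(3) mu_dbl_commutator)
  thus "mu (dbl a b) - mu (dbl a' b') \<in> commutator_space"
    by (simp add: linear_pmD(3)[OF dbl_linear(1)] linear_pmD(3)[OF dbl_linear(2)] linear_pmD(3)[OF linear_mu])
qed

section \<open>The quotient variety of two-dimensional representations\<close>

fun word_eval :: "complex^2^2 \<Rightarrow> complex^2^2 \<Rightarrow> letter list \<Rightarrow> complex^2^2" where
  "word_eval A B [] = mat 1"
| "word_eval A B (Ltr_x # w) = A ** word_eval A B w"
| "word_eval A B (Ltr_xs # w) = B ** word_eval A B w"

definition rep_eval :: "complex^2^2 \<Rightarrow> complex^2^2 \<Rightarrow> alg \<Rightarrow> complex^2^2" where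
  "rep_eval A B a =
     (\<Sum>w\<in>Poly_Mapping.keys a. mat (Poly_Mapping.lookup a w) ** word_eval A B (letters w))"

text \<open>The affine quotient of pairs of matrices under simultaneous conjugation, realised as affine
  5-space through the five generators of its coordinate ring.\<close>

definition iss_point :: "complex^2^2 \<Rightarrow> complex^2^2 \<Rightarrow> complex^5" where
  "iss_point A B = vector [trace A, trace B, trace (A ** A), trace (B ** B), trace (A ** B)]"

inductive_set regular :: "(complex^5 \<Rightarrow> complex) set" where
  const: "(\<lambda>_. c) \<in> regular"
| coord: "(\<lambda>\<rho>. \<rho> $ i) \<in> regular"
| add: "f \<in> regular \<Longrightarrow> g \<in> regular \<Longrightarrow> (\<lambda>\<rho>. f \<rho> + g \<rho>) \<in> regular"
| mult: "f \<in> regular \<Longrightarrow> g \<in> regular \<Longrightarrow> (\<lambda>\<rho>. f \<rho> * g \<rho>) \<in> regular"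

lemma regular_neg: "f \<in> regular \<Longrightarrow> (\<lambda>\<rho>. - f \<rho>) \<in> regular"
  using regular.mult[OF regular.const[of "-1"], of f] by simp

lemma regular_diff: "f \<in> regular \<Longrightarrow> g \<in> regular \<Longrightarrow> (\<lambda>\<rho>. f \<rho> - g \<rho>) \<in> regular"
  using regular.add[of f "\<lambda>\<rho>. - g \<rho>"] regular_neg[of g] by simp

lemma regular_sum: "(\<And>i. i \<in> S \<Longrightarrow> f i \<in> regular) \<Longrightarrow> (\<lambda>\<rho>. \<Sum>i\<in>S. f i \<rho>) \<in> regular"
  by (induction S rule: infinite_finite_induct) (auto intro: regular.intros)

lemma exhaust_5: "x = 1 \<or> x = 2 \<or> x = 3 \<or> x = 4 \<or> x = 5" for x :: 5
proof (induct x)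
  case (of_int z)
  then have "z = 0 \<or> z = 1 \<or> z = 2 \<or> z = 3 \<or> z = 4" by fastforce
  then show ?case by auto
qed

lemma forall_5: "(\<forall>i::5. P i) \<longleftrightarrow> P 1 \<and> P 2 \<and> P 3 \<and> P 4 \<and> P 5"
  by (metis exhaust_5)

lemma UNIV_5: "UNIV = {1, 2, 3, 4, 5::5}"
  using exhaust_5 by auto

lemma sum_5: "sum f (UNIV::5 set) = f 1 + f 2 + f 3 + f 4 + f 5"
  unfolding UNIV_5 by (simp add: ac_simps)

lemma vector_5 [simp]:
  "(vector [a, b, c, d, e] :: 'a::zero^5) $ 1 = a"
  "(vector [a, b, c, d, e] :: 'a::zero^5) $ 2 = b"
  "(vector [a, b, c, d, e] :: 'a::zero^5) $ 3 = c"
  "(vector [a, b, c, d, e] :: 'a::zero^5) $ 4 = d"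
  "(vector [a, b, c, d, e] :: 'a::zero^5) $ 5 = e"
  unfolding vector_def by simp_all

lemmas mat2_simps = vec_eq_iff forall_2 sum_2 matrix_matrix_mult_def mat_def trace_def

lemma iss_point_conjugate:
  assumes "invertible g"
  shows "iss_point (g ** A ** matrix_inv g) (g ** B ** matrix_inv g) = iss_point A B"
proof -
  have ig: "matrix_inv g ** g = mat 1"
    using assms unfolding invertible_def matrix_inv_def by (metis (mono_tags, lifting) someI_ex)
  have gi: "matrix_inv g ** (g ** M) = M" for M
    by (simp add: matrix_mul_assoc ig)
  have "trace (g ** (M ** matrix_inv g)) = trace M" for M
    by (subst trace_mul_sym) (simp add: ig flip: matrix_mul_assoc)
  note t = this
  have t2: "trace (g ** (M ** (N ** matrix_inv g))) = trace (M ** N)" for M N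
    using t[of "M ** N"] by (simp flip: matrix_mul_assoc)
  show ?thesis
    by (simp add: iss_point_def gi t t2 flip: matrix_mul_assoc)
qed

lemma iss_point_surj: "\<exists>A B. iss_point A B = \<rho>"
proof -
  define s t where "s = \<rho> $ 1" and "t = \<rho> $ 2"
  define z where "z = csqrt (2 * \<rho> $ 4 - t\<^sup>2)"
  define w where "w = (t + z) / 2"
  have z: "z * z = 2 * \<rho> $ 4 - t * t" unfolding z_def by (metis power2_csqrt power2_eq_square)
  define A :: "complex^2^2" where "A = vector [vector [0, (\<rho> $ 3 - s * s) / 2], vector [1, s]]"
  define B :: "complex^2^2" where "B = vector [vector [t - w, \<rho> $ 5 - s * w], vector [0, w]]"
  have "(t - w) * (t - w) + w * w = (t * t + z * z) / 2"
    by (simp add: w_def field_simps)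
  hence B: "(t - w) * (t - w) + w * w = \<rho> $ 4" using z by simp
  have "iss_point A B = \<rho>"
    unfolding vec_eq_iff forall_5
    by (simp add: iss_point_def A_def B_def trace_def matrix_matrix_mult_def sum_2 B
        s_def[symmetric] t_def[symmetric])
  thus ?thesis by blast
qed

lemma rep_eval_superset:
  assumes "finite S" "Poly_Mapping.keys a \<subseteq> S"
  shows "rep_eval A B a = (\<Sum>w\<in>S. mat (Poly_Mapping.lookup a w) ** word_eval A B (letters w))"
  unfolding rep_eval_def using assms
  by (intro sum.mono_neutral_left) (auto simp: in_keys_iff mat_def zero_vec_def vec_eq_iff matrix_matrix_mult_def)

lemma rep_eval_add: "rep_eval A B (a + b) = rep_eval A B a + rep_eval A B b"
proof -
  let ?S = "Poly_Mapping.keys a \<union> Poly_Mapping.keys b"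
  have "Poly_Mapping.keys (a + b) \<subseteq> ?S" by (rule Poly_Mapping.keys_add)
  moreover have "mat (c + d) ** M = mat c ** M + mat d ** M" for c d and M :: "complex^2^2"
    by (simp add: mat2_simps algebra_simps)
  ultimately show ?thesis
    by (simp add: rep_eval_superset[where S="?S"] lookup_add sum.distrib)
qed

lemma rep_eval_scal: "rep_eval A B (scal c a) = mat c ** rep_eval A B a"
proof -
  have "Poly_Mapping.keys (scal c a) \<subseteq> Poly_Mapping.keys a" by (auto simp: in_keys_iff)
  moreover have "mat (c * d) ** M = mat c ** (mat d ** M)" for d and M :: "complex^2^2"
    by (simp add: mat2_simps algebra_simps)
  moreover have "mat c ** sum f S = (\<Sum>w\<in>S. mat c ** f w)" for f :: "word \<Rightarrow> complex^2^2" and S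
    by (induction S rule: infinite_finite_induct) (simp_all add: mat2_simps algebra_simps)
  ultimately show ?thesis
    by (simp add: rep_eval_superset[where S="Poly_Mapping.keys a"])
qed

lemma rep_eval_basis [simp]: "rep_eval A B (basis w) = word_eval A B (letters w)"
  by (simp add: rep_eval_def)

lemma pm_induct [case_names zero basis add]:
  fixes a :: "'k \<Rightarrow>\<^sub>0 complex"
  assumes "P 0" "\<And>c k. P (scal c (basis k))" "\<And>a b. P a \<Longrightarrow> P b \<Longrightarrow> P (a + b)"
  shows "P a"
proof -
  have "P (\<Sum>k\<in>S. scal (Poly_Mapping.lookup a k) (basis k))" for S
    by (induction S rule: infinite_finite_induct) (auto intro: assms)
  thus ?thesis using pm_expand[of a] by metis
qed

lemma word_eval_append: "word_eval A B (u @ v) = word_eval A B u ** word_eval A B v"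
  by (induction u rule: word_eval.induct[of "\<lambda>_ _ u. word_eval A B (u @ v) = word_eval A B u ** word_eval A B v" A B])
    (auto simp: matrix_mul_assoc)

lemma matrix_add_rdistrib: "(M + N) ** L = M ** L + N ** L" for L M N :: "complex^2^2"
  by (simp add: mat2_simps algebra_simps)

lemma mat_commute: "M ** mat c = mat c ** M" for M :: "complex^2^2"
  by (simp add: mat2_simps algebra_simps)

lemma rep_eval_zero [simp]: "rep_eval A B 0 = 0"
  by (simp add: rep_eval_def)

lemma rep_eval_mult: "rep_eval A B (a * b) = rep_eval A B a ** rep_eval A B b"
proof (induction a rule: pm_induct)
  case (basis c u)
  show ?case
  proof (induction b rule: pm_induct)
    case (basis d v)
    have "scal c (basis u) * scal d (basis v) = scal c (scal d (basis (u + v)))"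
      by (simp add: scal_mult mult_single mult.commute)
    hence "rep_eval A B (scal c (basis u) * scal d (basis v)) =
        mat c ** (mat d ** (word_eval A B (letters u) ** word_eval A B (letters v)))"
      by (simp only: rep_eval_scal rep_eval_basis) (simp add: plus_word_def word_eval_append)
    also have "\<dots> = (mat c ** word_eval A B (letters u)) ** (mat d ** word_eval A B (letters v))"
      by (metis mat_commute matrix_mul_assoc)
    finally show ?case by (simp only: rep_eval_scal rep_eval_basis)
  qed (simp_all add: distrib_left rep_eval_add matrix_add_ldistrib)
qed (simp_all add: distrib_right rep_eval_add matrix_add_rdistrib)

lemma cayley_hamilton_reduce:
  fixes A B :: "complex^2^2"
  defines "dA \<equiv> (1/2) * (trace A * trace A - trace (A ** A))"
    and "dB \<equiv> (1/2) * (trace B * trace B - trace (B ** B))"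
    and "e \<equiv> trace (A ** B) - trace A * trace B"
  shows "A ** (mat a + mat b ** A + mat c ** B + mat d ** (A ** B)) =
      mat (- b * dA) + mat (a + b * trace A) ** A + mat (- d * dA) ** B + mat (c + d * trace A) ** (A ** B)"
    and "B ** (mat a + mat b ** A + mat c ** B + mat d ** (A ** B)) =
      mat (b * e - c * dB - d * trace A * dB) + mat (b * trace B + d * dB) ** A
      + mat (a + b * trace A + c * trace B + d * trace (A ** B)) ** B + mat (- b) ** (A ** B)"
proof -
  have dA: "dA = A$1$1 * A$2$2 - A$1$2 * A$2$1" and dB: "dB = B$1$1 * B$2$2 - B$1$2 * B$2$1"
    by (simp_all add: dA_def dB_def mat2_simps algebra_simps)
  show "A ** (mat a + mat b ** A + mat c ** B + mat d ** (A ** B)) =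
      mat (- b * dA) + mat (a + b * trace A) ** A + mat (- d * dA) ** B + mat (c + d * trace A) ** (A ** B)"
    unfolding dA by (simp add: mat2_simps algebra_simps)
  show "B ** (mat a + mat b ** A + mat c ** B + mat d ** (A ** B)) =
      mat (b * e - c * dB - d * trace A * dB) + mat (b * trace B + d * dB) ** A
      + mat (a + b * trace A + c * trace B + d * trace (A ** B)) ** B + mat (- b) ** (A ** B)"
    unfolding dB e_def by (simp add: mat2_simps algebra_simps)
qed

lemma word_eval_reduce:
  "\<exists>p0\<in>regular. \<exists>p1\<in>regular. \<exists>p2\<in>regular. \<exists>p3\<in>regular. \<forall>A B. word_eval A B w =
     mat (p0 (iss_point A B)) + mat (p1 (iss_point A B)) ** A + mat (p2 (iss_point A B)) ** B
     + mat (p3 (iss_point A B)) ** (A ** B)"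
proof (induction w)
  case Nil
  show ?case
    by (intro bexI[of _ "\<lambda>_. 1"] bexI[of _ "\<lambda>_. 0"] regular.const) (simp add: mat2_simps)
next
  case (Cons l w)
  then obtain p0 p1 p2 p3 where p: "p0 \<in> regular" "p1 \<in> regular" "p2 \<in> regular" "p3 \<in> regular"
    "\<And>A B. word_eval A B w =
     mat (p0 (iss_point A B)) + mat (p1 (iss_point A B)) ** A + mat (p2 (iss_point A B)) ** B
     + mat (p3 (iss_point A B)) ** (A ** B)" by blast
  note reg = p(1-4) regular.intros regular_diff regular_neg
  show ?case
  proof (cases l)
    case Ltr_x
    show ?thesis
    proof (intro bexI allI)
      fix A B :: "complex^2^2"
      let ?d = "\<lambda>\<rho>::complex^5. (1/2) * (\<rho>$1 * \<rho>$1 - \<rho>$3)"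
      show "word_eval A B (l # w) =
        mat ((\<lambda>\<rho>. - p1 \<rho> * ?d \<rho>) (iss_point A B))
        + mat ((\<lambda>\<rho>. p0 \<rho> + p1 \<rho> * \<rho>$1) (iss_point A B)) ** A
        + mat ((\<lambda>\<rho>. - p3 \<rho> * ?d \<rho>) (iss_point A B)) ** B
        + mat ((\<lambda>\<rho>. p2 \<rho> + p3 \<rho> * \<rho>$1) (iss_point A B)) ** (A ** B)"
        unfolding Ltr_x word_eval.simps p(5) cayley_hamilton_reduce(1)
        by (simp only: iss_point_def vector_5)
    qed (intro reg)+
  next
    case Ltr_xs
    show ?thesis
    proof (intro bexI allI)
      fix A B :: "complex^2^2"
      let ?d = "\<lambda>\<rho>::complex^5. (1/2) * (\<rho>$2 * \<rho>$2 - \<rho>$4)"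
      let ?e = "\<lambda>\<rho>::complex^5. \<rho>$5 - \<rho>$1 * \<rho>$2"
      show "word_eval A B (l # w) =
        mat ((\<lambda>\<rho>. p1 \<rho> * ?e \<rho> - p2 \<rho> * ?d \<rho> - p3 \<rho> * \<rho>$1 * ?d \<rho>) (iss_point A B))
        + mat ((\<lambda>\<rho>. p1 \<rho> * \<rho>$2 + p3 \<rho> * ?d \<rho>) (iss_point A B)) ** A
        + mat ((\<lambda>\<rho>. p0 \<rho> + p1 \<rho> * \<rho>$1 + p2 \<rho> * \<rho>$2 + p3 \<rho> * \<rho>$5) (iss_point A B)) ** B
        + mat ((\<lambda>\<rho>. - p1 \<rho>) (iss_point A B)) ** (A ** B)"
        unfolding Ltr_xs word_eval.simps p(5) cayley_hamilton_reduce(2)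
        by (simp only: iss_point_def vector_5)
    qed (intro reg)+
  qed
qed

lemma trace_function_exists:
  "\<exists>p\<in>regular. \<forall>A B. p (iss_point A B) = trace (rep_eval A B a)"
proof (induction a rule: pm_induct)
  case zero
  show ?case by (intro bexI[of _ "\<lambda>_. 0"] regular.const) (simp add: trace_def)
next
  case (basis c w)
  obtain p0 p1 p2 p3 where p: "p0 \<in> regular" "p1 \<in> regular" "p2 \<in> regular" "p3 \<in> regular"
    "\<And>A B. word_eval A B (letters w) =
     mat (p0 (iss_point A B)) + mat (p1 (iss_point A B)) ** A + mat (p2 (iss_point A B)) ** B
     + mat (p3 (iss_point A B)) ** (A ** B)"
    using word_eval_reduce[of "letters w"] by blast
  have tr: "trace (mat k ** M) = k * trace M" "trace (mat k :: complex^2^2) = 2 * k"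
    for k and M :: "complex^2^2"
    by (simp_all add: mat2_simps algebra_simps)
  show ?case
  proof (intro bexI allI)
    fix A B :: "complex^2^2"
    show "(\<lambda>\<rho>. c * (2 * p0 \<rho> + p1 \<rho> * \<rho>$1 + p2 \<rho> * \<rho>$2 + p3 \<rho> * \<rho>$5)) (iss_point A B) =
        trace (rep_eval A B (scal c (basis w)))"
      unfolding rep_eval_scal rep_eval_basis p(5) tr trace_add by (simp add: iss_point_def)
  qed (intro p(1-4) regular.intros)+
next
  case (add a b)
  then obtain p q where "p \<in> regular" "q \<in> regular"
    "\<And>A B. p (iss_point A B) = trace (rep_eval A B a)"
    "\<And>A B. q (iss_point A B) = trace (rep_eval A B b)" by blast
  thus ?case
    by (intro bexI[of _ "\<lambda>\<rho>. p \<rho> + q \<rho>"] regular.intros) (simp_all add: rep_eval_add trace_add)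
qed

lemma trace_function_unique:
  assumes "\<And>A B. p (iss_point A B) = q (iss_point A B)"
  shows "p = q"
proof
  fix \<rho>
  obtain A B where "iss_point A B = \<rho>" using iss_point_surj by blast
  thus "p \<rho> = q \<rho>" using assms[of A B] by simp
qed

definition alg_trace :: "alg \<Rightarrow> (complex^5 \<Rightarrow> complex)" where
  "alg_trace a = (THE p. p \<in> regular \<and> (\<forall>A B. p (iss_point A B) = trace (rep_eval A B a)))"

lemma alg_trace:
  "alg_trace a \<in> regular" "alg_trace a (iss_point A B) = trace (rep_eval A B a)"
proof -
  have "\<exists>!p. p \<in> regular \<and> (\<forall>A B. p (iss_point A B) = trace (rep_eval A B a))"
    using trace_function_exists[of a] trace_function_unique by (metis (no_types, lifting))
  from theI'[OF this]
  show "alg_trace a \<in> regular" "alg_trace a (iss_point A B) = trace (rep_eval A B a)"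
    by (simp_all add: alg_trace_def)
qed

lemma trace_commutator:
  assumes "s \<in> commutator_space"
  shows "trace (rep_eval A B s) = 0"
  using assms unfolding commutator_space_def
proof (induction rule: pm.span_induct_alt)
  case base
  show ?case by (simp add: trace_def)
next
  case (step c x y)
  then obtain a b where "x = a * b - b * a" by blast
  hence x: "x + b * a = a * b" by simp
  have "trace (rep_eval A B x) = 0"
    using arg_cong[OF x, of "\<lambda>z. trace (rep_eval A B z)"] trace_mul_sym[of "rep_eval A B a" "rep_eval A B b"]
    by (simp add: rep_eval_add rep_eval_mult trace_add)
  moreover have "trace (mat c ** M) = c * trace M" for M :: "complex^2^2"
    by (simp add: mat2_simps algebra_simps)
  ultimately show ?case using step by (simp add: rep_eval_add rep_eval_scal trace_add)
qed

lift_definition necklace_trace :: "necklace \<Rightarrow> (complex^5 \<Rightarrow> complex)" is alg_trace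
proof (rule trace_function_unique)
  fix a b A B
  assume "a - b \<in> commutator_space"
  from trace_commutator[OF this, of A B]
  have "trace (rep_eval A B (a - b)) = 0" .
  moreover have "rep_eval A B a = rep_eval A B (a - b) + rep_eval A B b"
    by (simp flip: rep_eval_add)
  ultimately show "alg_trace a (iss_point A B) = alg_trace b (iss_point A B)"
    by (simp add: alg_trace trace_add)
qed

section \<open>Poisson structures and symplectic leaves\<close>

definition poisson_bracket ::
  "((complex^5 \<Rightarrow> complex) \<Rightarrow> (complex^5 \<Rightarrow> complex) \<Rightarrow> (complex^5 \<Rightarrow> complex)) \<Rightarrow> bool" where
  "poisson_bracket P \<longleftrightarrow>
     (\<forall>f\<in>regular. \<forall>g\<in>regular. P f g \<in> regular) \<and>
     (\<forall>f\<in>regular. \<forall>g\<in>regular. \<forall>h\<in>regular. \<forall>c.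
        P f (\<lambda>\<rho>. g \<rho> + h \<rho>) = (\<lambda>\<rho>. P f g \<rho> + P f h \<rho>) \<and>
        P f (\<lambda>\<rho>. c * g \<rho>) = (\<lambda>\<rho>. c * P f g \<rho>) \<and>
        P f g = (\<lambda>\<rho>. - P g f \<rho>) \<and>
        P f (\<lambda>\<rho>. g \<rho> * h \<rho>) = (\<lambda>\<rho>. P f g \<rho> * h \<rho> + g \<rho> * P f h \<rho>) \<and>
        (\<lambda>\<rho>. P f (P g h) \<rho> + P g (P h f) \<rho> + P h (P f g) \<rho>) = (\<lambda>_. 0))"

definition necklace_poisson ::
  "((complex^5 \<Rightarrow> complex) \<Rightarrow> (complex^5 \<Rightarrow> complex) \<Rightarrow> (complex^5 \<Rightarrow> complex)) \<Rightarrow> bool" where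
  "necklace_poisson P \<longleftrightarrow> poisson_bracket P \<and>
     (\<forall>w1 w2. P (necklace_trace w1) (necklace_trace w2) = necklace_trace (necklace_bracket w1 w2))"

definition hamiltonian_field ::
  "((complex^5 \<Rightarrow> complex) \<Rightarrow> (complex^5 \<Rightarrow> complex) \<Rightarrow> (complex^5 \<Rightarrow> complex)) \<Rightarrow>
    (complex^5 \<Rightarrow> complex) \<Rightarrow> complex^5 \<Rightarrow> complex^5" where
  "hamiltonian_field P f \<rho> = (\<chi> i. P f (\<lambda>\<sigma>. \<sigma> $ i) \<rho>)"

text \<open>Symplectic leaves in the sense of Weinstein: the classes of points joined by paths that are
  piecewise integral curves of Hamiltonian vector fields. Time is real; as the Hamiltonians are
  complex polynomials, passing from \<open>f\<close> to \<open>- f\<close> reverses a segment (so the reflexive transitive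
  closure below is an equivalence relation, and the sign convention for Hamiltonian fields is
  irrelevant), and passing from \<open>f\<close> to \<open>\<i> * f\<close> covers imaginary time. Since the differentials of
  regular functions span every cotangent space of affine space, admitting locally defined
  holomorphic Hamiltonians would give the same leaves.\<close>

definition hamiltonian_segment ::
  "((complex^5 \<Rightarrow> complex) \<Rightarrow> (complex^5 \<Rightarrow> complex) \<Rightarrow> (complex^5 \<Rightarrow> complex)) \<Rightarrow>
    complex^5 \<Rightarrow> complex^5 \<Rightarrow> bool" where
  "hamiltonian_segment P \<rho> \<sigma> \<longleftrightarrow> (\<exists>f\<in>regular. \<exists>\<gamma> :: real \<Rightarrow> complex^5. \<exists>a b. a \<le> b \<and>
     (\<forall>t\<in>{a..b}. (\<gamma> has_vector_derivative hamiltonian_field P f (\<gamma> t)) (at t within {a..b})) \<and>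
     \<gamma> a = \<rho> \<and> \<gamma> b = \<sigma>)"

definition symplectic_leaf ::
  "((complex^5 \<Rightarrow> complex) \<Rightarrow> (complex^5 \<Rightarrow> complex) \<Rightarrow> (complex^5 \<Rightarrow> complex)) \<Rightarrow>
    complex^5 \<Rightarrow> (complex^5) set" where
  "symplectic_leaf P \<rho> = {\<sigma>. (hamiltonian_segment P)\<^sup>*\<^sup>* \<rho> \<sigma>}"

definition symplectic_leaves ::
  "((complex^5 \<Rightarrow> complex) \<Rightarrow> (complex^5 \<Rightarrow> complex) \<Rightarrow> (complex^5 \<Rightarrow> complex)) \<Rightarrow>
    (complex^5) set set" where
  "symplectic_leaves P = range (symplectic_leaf P)"

section \<open>Coadjoint orbits of the Lie algebra of traceless matrices\<close>

definition sl2 :: "(complex^2^2) set" where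
  "sl2 = {a. trace a = 0}"

definition sl2_dual :: "(complex^2^2 \<Rightarrow> complex) set" where
  "sl2_dual = {\<xi> \<in> extensional sl2.
     (\<forall>a\<in>sl2. \<forall>b\<in>sl2. \<xi> (a + b) = \<xi> a + \<xi> b) \<and> (\<forall>c. \<forall>a\<in>sl2. \<xi> (mat c ** a) = c * \<xi> a)}"

definition coadjoint :: "complex^2^2 \<Rightarrow> (complex^2^2 \<Rightarrow> complex) \<Rightarrow> (complex^2^2 \<Rightarrow> complex)" where
  "coadjoint g \<xi> = (\<lambda>a\<in>sl2. \<xi> (matrix_inv g ** a ** g))"

definition coadjoint_orbit :: "(complex^2^2 \<Rightarrow> complex) \<Rightarrow> (complex^2^2 \<Rightarrow> complex) set" where
  "coadjoint_orbit \<xi> = {coadjoint g \<xi> | g. det g = 1}"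

definition coadjoint_orbits :: "(complex^2^2 \<Rightarrow> complex) set set" where
  "coadjoint_orbits = coadjoint_orbit ` sl2_dual"

section \<open>The copy of the symmetric algebra and its Casimir element\<close>

definition fH :: "complex^5 \<Rightarrow> complex" where "fH \<rho> = alg_trace (gx * gxs) \<rho>"
definition fF :: "complex^5 \<Rightarrow> complex" where "fF \<rho> = - (alg_trace (gx * gx) \<rho> / 2)"
definition fE :: "complex^5 \<Rightarrow> complex" where "fE \<rho> = alg_trace (gxs * gxs) \<rho> / 2"
definition fX :: "complex^5 \<Rightarrow> complex" where "fX \<rho> = alg_trace gxs \<rho>"
definition fY :: "complex^5 \<Rightarrow> complex" where "fY \<rho> = - alg_trace gx \<rho>"

definition H' :: "complex^5 \<Rightarrow> complex" where "H' \<rho> = fH \<rho> + fX \<rho> * fY \<rho> / 2"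
definition E' :: "complex^5 \<Rightarrow> complex" where "E' \<rho> = fE \<rho> - (fX \<rho>)\<^sup>2 / 4"
definition F' :: "complex^5 \<Rightarrow> complex" where "F' \<rho> = fF \<rho> + (fY \<rho>)\<^sup>2 / 4"

definition casimir :: "complex^5 \<Rightarrow> complex" where
  "casimir \<rho> = (H' \<rho>)\<^sup>2 + 4 * E' \<rho> * F' \<rho>"

text \<open>The point of the dual determined by the coordinate functions: it takes the standard basis
  \<open>e, f, h\<close> of traceless matrices to \<open>E', F', H'\<close>.\<close>

definition sl2_map :: "complex^5 \<Rightarrow> (complex^2^2 \<Rightarrow> complex)" where
  "sl2_map \<rho> = (\<lambda>a\<in>sl2. a$1$2 * E' \<rho> + a$2$1 * F' \<rho> + a$1$1 * H' \<rho>)"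

definition level_set :: "complex \<Rightarrow> (complex^5) set" where
  "level_set l = {\<rho>. casimir \<rho> = l}"

definition S0' :: "(complex^5) set" where
  "S0' = {\<rho>. casimir \<rho> = 0 \<and> (E' \<rho>, F' \<rho>, H' \<rho>) \<noteq> (0, 0, 0)}"

definition S0'' :: "(complex^5) set" where
  "S0'' = {\<rho>. (E' \<rho>, F' \<rho>, H' \<rho>) = (0, 0, 0)}"

section \<open>Existence of the induced Poisson bracket\<close>

definition is_grad :: "(complex^5 \<Rightarrow> complex) \<Rightarrow> (5 \<Rightarrow> complex^5 \<Rightarrow> complex) \<Rightarrow> bool" where
  "is_grad f g \<longleftrightarrow> (\<forall>i. g i \<in> regular) \<and>
     (\<forall>(\<gamma> :: 5 \<Rightarrow> complex \<Rightarrow> complex) \<gamma>' t. (\<forall>i. (\<gamma> i has_field_derivative \<gamma>' i) (at t)) \<longrightarrow>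
       ((\<lambda>s. f (\<chi> i. \<gamma> i s)) has_field_derivative (\<Sum>i\<in>UNIV. g i (\<chi> i. \<gamma> i t) * \<gamma>' i)) (at t))"

lemma is_grad_const: "is_grad (\<lambda>_. c) (\<lambda>_ _. 0)"
  unfolding is_grad_def by (auto intro: regular.const)

lemma is_grad_coord: "is_grad (\<lambda>\<rho>. \<rho> $ k) (\<lambda>i _. if i = k then 1 else 0)"
  unfolding is_grad_def by (auto intro: regular.const simp: if_distrib[of "\<lambda>x. x * _"] cong: if_cong)

lemma is_grad_add:
  assumes "is_grad f f'" "is_grad g g'"
  shows "is_grad (\<lambda>\<rho>. f \<rho> + g \<rho>) (\<lambda>i \<rho>. f' i \<rho> + g' i \<rho>)"
  using assms unfolding is_grad_def
  by (auto intro!: regular.intros DERIV_add simp: distrib_right sum.distrib)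

lemma is_grad_mult:
  assumes "is_grad f f'" "is_grad g g'" "f \<in> regular" "g \<in> regular"
  shows "is_grad (\<lambda>\<rho>. f \<rho> * g \<rho>) (\<lambda>i \<rho>. f \<rho> * g' i \<rho> + f' i \<rho> * g \<rho>)"
  unfolding is_grad_def
proof (intro conjI allI impI)
  show "(\<lambda>\<rho>. f \<rho> * g' i \<rho> + f' i \<rho> * g \<rho>) \<in> regular" for i
    using assms by (auto simp: is_grad_def intro!: regular.intros)
  fix \<gamma> :: "5 \<Rightarrow> complex \<Rightarrow> complex" and \<gamma>' t
  assume \<gamma>: "\<forall>i. (\<gamma> i has_field_derivative \<gamma>' i) (at t)"
  have "((\<lambda>s. f (\<chi> i. \<gamma> i s) * g (\<chi> i. \<gamma> i s)) has_field_derivative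
     f (\<chi> i. \<gamma> i t) * (\<Sum>i\<in>UNIV. g' i (\<chi> i. \<gamma> i t) * \<gamma>' i) +
     (\<Sum>i\<in>UNIV. f' i (\<chi> i. \<gamma> i t) * \<gamma>' i) * g (\<chi> i. \<gamma> i t)) (at t)"
    using assms \<gamma> unfolding is_grad_def by (intro DERIV_mult') auto
  also have "f (\<chi> i. \<gamma> i t) * (\<Sum>i\<in>UNIV. g' i (\<chi> i. \<gamma> i t) * \<gamma>' i) +
     (\<Sum>i\<in>UNIV. f' i (\<chi> i. \<gamma> i t) * \<gamma>' i) * g (\<chi> i. \<gamma> i t) =
     (\<Sum>i\<in>UNIV. (f (\<chi> i. \<gamma> i t) * g' i (\<chi> i. \<gamma> i t) + f' i (\<chi> i. \<gamma> i t) * g (\<chi> i. \<gamma> i t)) * \<gamma>' i)"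
    by (simp add: sum_distrib_left sum_distrib_right sum.distrib algebra_simps)
  finally show "((\<lambda>s. f (\<chi> i. \<gamma> i s) * g (\<chi> i. \<gamma> i s)) has_field_derivative
    (\<Sum>i\<in>UNIV. (f (\<chi> i. \<gamma> i t) * g' i (\<chi> i. \<gamma> i t) + f' i (\<chi> i. \<gamma> i t) * g (\<chi> i. \<gamma> i t)) * \<gamma>' i)) (at t)" .
qed

lemma is_gradD:
  assumes "is_grad f g" "\<And>i. (\<gamma> i has_field_derivative \<gamma>' i) (at t)"
  shows "((\<lambda>s. f (\<chi> i. \<gamma> i s)) has_field_derivative (\<Sum>i\<in>UNIV. g i (\<chi> i. \<gamma> i t) * \<gamma>' i)) (at t)"
  using assms unfolding is_grad_def by blast

lemma is_grad_unique:
  assumes "is_grad f g" "is_grad f h"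
  shows "g = h"
proof (intro ext)
  fix k and \<rho> :: "complex^5"
  let ?\<gamma> = "\<lambda>i s. \<rho> $ i + (if i = k then s else 0)"
  let ?d = "\<lambda>i. if i = k then 1 else 0"
  have \<gamma>: "(?\<gamma> i has_field_derivative ?d i) (at 0)" for i
    by (auto intro!: derivative_eq_intros)
  have \<rho>: "(\<chi> i. ?\<gamma> i 0) = \<rho>" by (simp add: vec_eq_iff)
  note D = is_gradD[where \<gamma>="?\<gamma>" and \<gamma>'="?d", OF _ \<gamma>]
  from DERIV_unique[OF D[OF assms(1)] D[OF assms(2)]] show "g k \<rho> = h k \<rho>"
    unfolding \<rho> by (simp add: if_distrib cong: if_cong)
qed

definition grad :: "(complex^5 \<Rightarrow> complex) \<Rightarrow> 5 \<Rightarrow> complex^5 \<Rightarrow> complex" where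
  "grad f = (THE g. is_grad f g)"

lemma grad_eqI: "is_grad f g \<Longrightarrow> grad f = g"
  unfolding grad_def by (blast intro: is_grad_unique)

lemma grad_is_grad: "f \<in> regular \<Longrightarrow> is_grad f (grad f)"
proof (induction rule: regular.induct)
  case (const c)
  show ?case using grad_eqI[OF is_grad_const] is_grad_const by simp
next
  case (coord i)
  show ?case using grad_eqI[OF is_grad_coord] is_grad_coord by simp
next
  case (add f g)
  show ?case using is_grad_add[OF add.IH] grad_eqI[OF is_grad_add[OF add.IH]] by simp
next
  case (mult f g)
  show ?case using is_grad_mult[OF mult.IH mult.hyps] grad_eqI[OF is_grad_mult[OF mult.IH mult.hyps]] by simp
qed

lemma grad_regular: "f \<in> regular \<Longrightarrow> grad f i \<in> regular"
  using grad_is_grad[of f] by (simp add: is_grad_def)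

lemmas grad_const = grad_eqI[OF is_grad_const]
lemmas grad_coord = grad_eqI[OF is_grad_coord]
lemmas grad_add = grad_eqI[OF is_grad_add[OF grad_is_grad grad_is_grad]]
lemmas grad_mult = grad_eqI[OF is_grad_mult[OF grad_is_grad grad_is_grad]]

text \<open>The table of brackets of the coordinates, in the order
  \<open>tr x, tr x*, tr x\<^sup>2, tr (x*)\<^sup>2, tr xx*\<close>.\<close>

definition table :: "5 \<Rightarrow> 5 \<Rightarrow> complex^5 \<Rightarrow> complex" where
  "table i j \<rho> = (vector [
     vector [0, 2, 0, 2 * \<rho>$2, \<rho>$1],
     vector [-2, 0, -2 * \<rho>$1, 0, - \<rho>$2],
     vector [0, 2 * \<rho>$1, 0, 4 * \<rho>$5, 2 * \<rho>$3],
     vector [-2 * \<rho>$2, 0, -4 * \<rho>$5, 0, -2 * \<rho>$4],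
     vector [- \<rho>$1, \<rho>$2, -2 * \<rho>$3, 2 * \<rho>$4, 0]] :: complex^5^5) $ i $ j"

definition std_poisson :: "(complex^5 \<Rightarrow> complex) \<Rightarrow> (complex^5 \<Rightarrow> complex) \<Rightarrow> (complex^5 \<Rightarrow> complex)" where
  "std_poisson f g \<rho> = (\<Sum>i\<in>UNIV. \<Sum>j\<in>UNIV. grad f i \<rho> * grad g j \<rho> * table i j \<rho>)"

lemma regular_linear: "(\<lambda>\<rho>. c * \<rho> $ i) \<in> regular"
  using regular.mult[OF regular.const regular.coord] .

lemma table_regular: "table i j \<in> regular"
proof -
  have "\<forall>i j. table i j \<in> regular"
    unfolding forall_5 table_def
    using regular_linear[of 1 1] regular_linear[of "-1" 1] regular_linear[of 1 2] regular_linear[of "-1" 2]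
    by (simp add: regular.const regular_linear regular_neg)
  thus ?thesis by blast
qed

lemma table_antisym: "table i j \<rho> = - table j i \<rho>"
proof -
  have "\<forall>i j. table i j \<rho> = - table j i \<rho>"
    unfolding forall_5 table_def by simp
  thus ?thesis by blast
qed

lemma std_poisson_regular: "f \<in> regular \<Longrightarrow> g \<in> regular \<Longrightarrow> std_poisson f g \<in> regular"
proof -
  assume "f \<in> regular" "g \<in> regular"
  hence "(\<lambda>\<rho>. grad f i \<rho> * grad g j \<rho> * table i j \<rho>) \<in> regular" for i j
    by (simp add: regular.mult grad_regular table_regular)
  hence "(\<lambda>\<rho>. \<Sum>i\<in>UNIV. \<Sum>j\<in>UNIV. grad f i \<rho> * grad g j \<rho> * table i j \<rho>) \<in> regular"
    by (rule regular_sum[OF regular_sum])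
  thus ?thesis by (simp add: std_poisson_def[abs_def])
qed

lemma std_poisson_antisym: "std_poisson f g = (\<lambda>\<rho>. - std_poisson g f \<rho>)"
proof
  fix \<rho>
  have "std_poisson f g \<rho> = (\<Sum>i\<in>UNIV. \<Sum>j\<in>UNIV. - (grad g j \<rho> * grad f i \<rho> * table j i \<rho>))"
    unfolding std_poisson_def
    by (intro sum.cong refl) (metis table_antisym mult.commute mult_minus_right)
  also have "\<dots> = - std_poisson g f \<rho>"
    unfolding std_poisson_def sum_negf by (subst sum.swap) simp
  finally show "std_poisson f g \<rho> = - std_poisson g f \<rho>" .
qed

lemma std_poisson_const: "std_poisson f (\<lambda>_. c) = (\<lambda>_. 0)"
  by (simp add: std_poisson_def grad_const fun_eq_iff)

lemma std_poisson_add: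
  assumes "g \<in> regular" "h \<in> regular"
  shows "std_poisson f (\<lambda>\<rho>. g \<rho> + h \<rho>) = (\<lambda>\<rho>. std_poisson f g \<rho> + std_poisson f h \<rho>)"
  by (simp add: std_poisson_def grad_add[OF assms] fun_eq_iff sum.distrib algebra_simps)

lemma std_poisson_mult:
  assumes "g \<in> regular" "h \<in> regular"
  shows "std_poisson f (\<lambda>\<rho>. g \<rho> * h \<rho>) = (\<lambda>\<rho>. std_poisson f g \<rho> * h \<rho> + g \<rho> * std_poisson f h \<rho>)"
proof
  fix \<rho>
  show "std_poisson f (\<lambda>\<rho>. g \<rho> * h \<rho>) \<rho> = std_poisson f g \<rho> * h \<rho> + g \<rho> * std_poisson f h \<rho>"
    unfolding std_poisson_def grad_mult[OF assms assms] sum_distrib_left sum_distrib_right sum.distrib[symmetric]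
    by (intro sum.cong refl) (simp add: algebra_simps)
qed

lemma std_poisson_cmult:
  assumes "g \<in> regular"
  shows "std_poisson f (\<lambda>\<rho>. c * g \<rho>) = (\<lambda>\<rho>. c * std_poisson f g \<rho>)"
  using std_poisson_mult[OF regular.const assms, of f c] by (simp add: std_poisson_const)

lemma std_poisson_coord: "std_poisson (\<lambda>\<rho>. \<rho> $ i) (\<lambda>\<rho>. \<rho> $ j) = table i j"
proof
  fix \<rho>
  have "std_poisson (\<lambda>\<rho>. \<rho> $ i) (\<lambda>\<rho>. \<rho> $ j) \<rho> =
      (\<Sum>i'\<in>UNIV. \<Sum>j'\<in>UNIV. if j' = j then if i' = i then table i j \<rho> else 0 else 0)"
    unfolding std_poisson_def grad_coord by (intro sum.cong refl) simp
  thus "std_poisson (\<lambda>\<rho>. \<rho> $ i) (\<lambda>\<rho>. \<rho> $ j) \<rho> = table i j \<rho>" by simp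
qed

definition jac where
  "jac f g h \<rho> = std_poisson f (std_poisson g h) \<rho> + std_poisson g (std_poisson h f) \<rho>
     + std_poisson h (std_poisson f g) \<rho>"

lemma jac_cyclic: "jac f g h = jac g h f"
  by (simp add: jac_def fun_eq_iff)

lemma jac_mult:
  assumes f: "f \<in> regular" and g: "g \<in> regular" and h: "h \<in> regular" and k: "k \<in> regular"
  shows "jac f g (\<lambda>\<rho>. h \<rho> * k \<rho>) \<rho> = jac f g h \<rho> * k \<rho> + h \<rho> * jac f g k \<rho>"
proof -
  have L: "std_poisson (\<lambda>\<rho>. h \<rho> * k \<rho>) e = (\<lambda>\<rho>. std_poisson h e \<rho> * k \<rho> + h \<rho> * std_poisson k e \<rho>)" for e
    unfolding std_poisson_antisym[of _ e] by (simp add: std_poisson_mult h k algebra_simps)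
  have D: "std_poisson e (\<lambda>\<rho>. u \<rho> * k \<rho> + h \<rho> * v \<rho>) = (\<lambda>\<rho>. std_poisson e u \<rho> * k \<rho> +
      u \<rho> * std_poisson e k \<rho> + (std_poisson e h \<rho> * v \<rho> + h \<rho> * std_poisson e v \<rho>))"
    if "u \<in> regular" "v \<in> regular" for e u v
    using that h k by (simp add: std_poisson_add std_poisson_mult regular.mult)
  show ?thesis
    unfolding jac_def L std_poisson_mult[OF h k] D[OF std_poisson_regular[OF g h] std_poisson_regular[OF g k]]
      D[OF std_poisson_regular[OF h f] std_poisson_regular[OF k f]]
    using fun_cong[OF std_poisson_antisym[of h f], of \<rho>] fun_cong[OF std_poisson_antisym[of k f], of \<rho>]
    by (simp add: algebra_simps)
qed

lemma jac_add:
  assumes f: "f \<in> regular" and g: "g \<in> regular" and h: "h \<in> regular" and k: "k \<in> regular"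
  shows "jac f g (\<lambda>\<rho>. h \<rho> + k \<rho>) \<rho> = jac f g h \<rho> + jac f g k \<rho>"
proof -
  have L: "std_poisson (\<lambda>\<rho>. h \<rho> + k \<rho>) e = (\<lambda>\<rho>. std_poisson h e \<rho> + std_poisson k e \<rho>)" for e
    unfolding std_poisson_antisym[of _ e] by (simp add: std_poisson_add h k)
  show ?thesis
    unfolding jac_def L std_poisson_add[OF h k]
    using std_poisson_add[OF std_poisson_regular[OF g h] std_poisson_regular[OF g k], of f]
      std_poisson_add[OF std_poisson_regular[OF h f] std_poisson_regular[OF k f], of g] by simp
qed

lemma jac_const: 
  assumes f: "f \<in> regular" and g: "g \<in> regular"
  shows "jac f g (\<lambda>_. c) \<rho> = 0"
proof -
  have "std_poisson (\<lambda>_. c) e = (\<lambda>_. 0)" for e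
    unfolding std_poisson_antisym[of _ e] by (simp add: std_poisson_const)
  thus ?thesis by (simp add: jac_def std_poisson_const)
qed

lemma jac_extend:
  assumes f: "f \<in> regular" and g: "g \<in> regular" and c: "\<And>i. jac f g (\<lambda>\<rho>. \<rho> $ i) = (\<lambda>_. 0)"
    and h: "h \<in> regular"
  shows "jac f g h = (\<lambda>_. 0)"
  using h by (induction rule: regular.induct) (auto simp: fun_eq_iff jac_const jac_add jac_mult f g c)

lemma std_poisson_linear:
  "std_poisson f (\<lambda>\<rho>. c * \<rho> $ i) = (\<lambda>\<rho>. c * std_poisson f (\<lambda>\<rho>. \<rho> $ i) \<rho>)"
  by (rule std_poisson_cmult[OF regular.coord])

lemma jac_coord: "jac (\<lambda>\<rho>. \<rho> $ i) (\<lambda>\<rho>. \<rho> $ j) (\<lambda>\<rho>. \<rho> $ k) = (\<lambda>_. 0)"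
proof -
  have neg: "std_poisson f (\<lambda>\<rho>. - \<rho> $ i) = (\<lambda>\<rho>. - std_poisson f (\<lambda>\<rho>. \<rho> $ i) \<rho>)" for f i
    using std_poisson_linear[of f "-1" i] by simp
  have neg2: "std_poisson f (\<lambda>\<rho>. - (c * \<rho> $ i)) = (\<lambda>\<rho>. - (c * std_poisson f (\<lambda>\<rho>. \<rho> $ i) \<rho>))" for f c i
    using std_poisson_linear[of f "-c" i] by simp
  have "\<forall>i j k. \<forall>\<rho>. jac (\<lambda>\<rho>. \<rho> $ i) (\<lambda>\<rho>. \<rho> $ j) (\<lambda>\<rho>. \<rho> $ k) \<rho> = 0"
    unfolding forall_5 jac_def std_poisson_coord table_def
    by (simp add: std_poisson_const std_poisson_linear neg neg2 std_poisson_coord table_def)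
  thus ?thesis by (simp add: fun_eq_iff)
qed

lemma jac_zero: "f \<in> regular \<Longrightarrow> g \<in> regular \<Longrightarrow> h \<in> regular \<Longrightarrow> jac f g h = (\<lambda>_. 0)"
proof -
  assume f: "f \<in> regular" and g: "g \<in> regular" and h: "h \<in> regular"
  note c = regular.coord
  have 1: "jac (\<lambda>\<rho>. \<rho> $ i) (\<lambda>\<rho>. \<rho> $ j) f = (\<lambda>_. 0)" if "f \<in> regular" for i j f
    by (rule jac_extend[OF c c jac_coord that])
  have 2: "jac (\<lambda>\<rho>. \<rho> $ j) f g = (\<lambda>_. 0)" if "f \<in> regular" "g \<in> regular" for j f g
  proof (rule jac_extend[OF c that(1) _ that(2)])
    show "jac (\<lambda>\<rho>. \<rho> $ j) f (\<lambda>\<rho>. \<rho> $ i) = (\<lambda>_. 0)" for i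
      by (simp only: 1[OF that(1)] flip: jac_cyclic[of "\<lambda>\<rho>. \<rho> $ i" "\<lambda>\<rho>. \<rho> $ j" f])
  qed
  show "jac f g h = (\<lambda>_. 0)"
  proof (rule jac_extend[OF f g _ h])
    show "jac f g (\<lambda>\<rho>. \<rho> $ i) = (\<lambda>_. 0)" for i
      by (simp only: 2[OF f g] flip: jac_cyclic[of "\<lambda>\<rho>. \<rho> $ i" f g])
  qed
qed

lemma std_poisson: "poisson_bracket std_poisson"
  unfolding poisson_bracket_def
proof (intro conjI ballI allI)
  fix f g h :: "complex^5 \<Rightarrow> complex" and c
  assume "f \<in> regular" "g \<in> regular" "h \<in> regular"
  from jac_zero[OF this]
  show "(\<lambda>\<rho>. std_poisson f (std_poisson g h) \<rho> + std_poisson g (std_poisson h f) \<rho> +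
      std_poisson h (std_poisson f g) \<rho>) = (\<lambda>_. 0)"
    by (simp only: jac_def[abs_def])
qed (rule std_poisson_regular std_poisson_add std_poisson_cmult std_poisson_antisym std_poisson_mult; assumption)+

definition lmat :: "complex^2^2 \<Rightarrow> complex^2^2 \<Rightarrow> letter \<Rightarrow> complex^2^2" where
  "lmat A B l = (case l of Ltr_x \<Rightarrow> A | Ltr_xs \<Rightarrow> B)"

lemma word_eval_Cons: "word_eval A B (l # w) = lmat A B l ** word_eval A B w"
  by (cases l) (simp_all add: lmat_def)

fun dword :: "complex^2^2 \<Rightarrow> complex^2^2 \<Rightarrow> complex^2^2 \<Rightarrow> complex^2^2 \<Rightarrow> letter list \<Rightarrow> complex^2^2" where
  "dword A B C E [] = 0"
| "dword A B C E (l # u) = lmat C E l ** word_eval A B u + lmat A B l ** dword A B C E u"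

definition cyc :: "complex^2^2 \<Rightarrow> complex^2^2 \<Rightarrow> letter \<Rightarrow> letter list \<Rightarrow> complex^2^2" where
  "cyc A B l u = (\<Sum>k<length u. if u ! k = l
     then word_eval A B (drop (Suc k) u) ** word_eval A B (take k u) else 0)"

lemma word_eval_deriv:
  "((\<lambda>s. word_eval (A + mat s ** C) (B + mat s ** E) u $ i $ j) has_field_derivative
     dword A B C E u $ i $ j) (at 0)"
proof (induction u arbitrary: i j)
  case Nil
  show ?case by simp
next
  case (Cons l u)
  let ?W = "\<lambda>s. word_eval (A + mat s ** C) (B + mat s ** E) u"
  have z: "mat 0 ** M = 0" for M :: "complex^2^2"
    by (simp add: mat2_simps)
  have L: "lmat (A + mat s ** C) (B + mat s ** E) l $ i $ k = lmat A B l $ i $ k + s * lmat C E l $ i $ k"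
    for s i k
    by (cases l) (auto simp: lmat_def matrix_matrix_mult_def sum_2 mat_def forall_2
        intro: exhaust_2[of i, THEN disjE])
  have "((\<lambda>s. \<Sum>k\<in>UNIV. (lmat A B l $ i $ k + s * lmat C E l $ i $ k) * ?W s $ k $ j) has_field_derivative
     (\<Sum>k\<in>UNIV. (lmat A B l $ i $ k + 0 * lmat C E l $ i $ k) * dword A B C E u $ k $ j
        + lmat C E l $ i $ k * ?W 0 $ k $ j)) (at 0)"
    by (intro DERIV_sum DERIV_mult' Cons.IH) (auto intro!: derivative_eq_intros)
  thus ?case
    by (simp add: word_eval_Cons matrix_matrix_mult_def[of "lmat _ _ _"] L z sum.distrib add.commute)
qed

lemma trace_deriv:
  "((\<lambda>s. trace (word_eval (A + mat s ** C) (B + mat s ** E) u)) has_field_derivative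
     trace (dword A B C E u)) (at 0)"
  unfolding trace_def by (intro DERIV_sum word_eval_deriv)

lemma trace_cyclic3: "trace (L ** M ** N) = trace (M ** N ** L)" for L M N :: "complex^2^2"
  by (metis matrix_mul_assoc trace_mul_sym)

lemma trace_dword:
  "trace (dword A B C E u ** N) = (\<Sum>k<length u. trace (lmat C E (u ! k) **
     (word_eval A B (drop (Suc k) u) ** (N ** word_eval A B (take k u)))))"
proof (induction u arbitrary: N)
  case Nil
  have "0 ** N = 0" by (simp add: mat2_simps)
  thus ?case by (simp add: trace_def)
next
  case (Cons l u)
  have "trace (dword A B C E (l # u) ** N) =
     trace (lmat C E l ** (word_eval A B u ** N)) + trace (lmat A B l ** dword A B C E u ** N)"
    by (simp add: matrix_add_rdistrib trace_add matrix_mul_assoc)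
  also have "trace (lmat A B l ** dword A B C E u ** N) = trace (dword A B C E u ** (N ** lmat A B l))"
    by (simp add: trace_cyclic3 matrix_mul_assoc)
  also have "\<dots> = (\<Sum>k<length u. trace (lmat C E (u ! k) **
     (word_eval A B (drop (Suc k) u) ** (N ** word_eval A B (take (Suc k) (l # u))))))"
    unfolding Cons.IH by (simp add: word_eval_Cons matrix_mul_assoc)
  finally show ?case
    by (simp add: sum.lessThan_Suc_shift del: sum.lessThan_Suc)
qed

lemma trace_zero: "trace (0 :: complex^2^2) = 0"
  by (simp add: trace_def)

lemma trace_mult_sum:
  "trace (M ** (\<Sum>k\<in>S. f k)) = (\<Sum>k\<in>S. trace (M ** f k))" for M :: "complex^2^2"
proof (induction S rule: infinite_finite_induct)
  case (insert x F)
  thus ?case by (simp add: matrix_add_ldistrib trace_add)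
qed (simp_all add: trace_def matrix_matrix_mult_def)

lemma trace_dword_cyc:
  "trace (dword A B C E u) = trace (C ** cyc A B Ltr_x u) + trace (E ** cyc A B Ltr_xs u)"
proof -
  have z: "trace (M ** 0) = 0" for M :: "complex^2^2"
    by (simp add: trace_def matrix_matrix_mult_def)
  have "trace (dword A B C E u) = trace (dword A B C E u ** mat 1)" by simp
  also have "\<dots> = (\<Sum>k<length u. trace (lmat C E (u ! k) **
     (word_eval A B (drop (Suc k) u) ** word_eval A B (take k u))))"
    unfolding trace_dword by simp
  also have "\<dots> = trace (C ** cyc A B Ltr_x u) + trace (E ** cyc A B Ltr_xs u)"
    unfolding cyc_def trace_mult_sum sum.distrib[symmetric]
  proof (intro sum.cong refl)
    fix k
    show "trace (lmat C E (u ! k) ** (word_eval A B (drop (Suc k) u) ** word_eval A B (take k u))) =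
      trace (C ** (if u ! k = Ltr_x then word_eval A B (drop (Suc k) u) ** word_eval A B (take k u) else 0)) +
      trace (E ** (if u ! k = Ltr_xs then word_eval A B (drop (Suc k) u) ** word_eval A B (take k u) else 0))"
      by (cases "u ! k") (simp_all add: lmat_def z trace_zero)
  qed
  finally show ?thesis .
qed

definition coord_word :: "5 \<Rightarrow> letter list" where
  "coord_word i = (if i = 1 then [Ltr_x] else if i = 2 then [Ltr_xs] else if i = 3 then [Ltr_x, Ltr_x]
     else if i = 4 then [Ltr_xs, Ltr_xs] else [Ltr_x, Ltr_xs])"

lemma iss_point_coord: "iss_point A B = (\<chi> i. trace (word_eval A B (coord_word i)))"
  unfolding vec_eq_iff forall_5 by (simp add: iss_point_def coord_word_def)

lemma trace_nondegenerate:
  fixes X Y :: "complex^2^2"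
  assumes "\<And>C. trace (C ** X) = trace (C ** Y)"
  shows "X = Y"
proof -
  have "X $ i $ j = Y $ i $ j" for i j
  proof -
    let ?C = "(\<chi> a b. if a = j \<and> b = i then 1 else 0) :: complex^2^2"
    have "\<forall>i j. trace (((\<chi> a b. if a = j \<and> b = i then 1 else 0) :: complex^2^2) ** Z) = Z $ i $ j"
      for Z :: "complex^2^2"
      unfolding forall_2 by (simp add: trace_def matrix_matrix_mult_def sum_2)
    thus ?thesis using assms[of ?C] by metis
  qed
  thus ?thesis by (simp add: vec_eq_iff)
qed

lemma alg_trace_basis: "alg_trace (basis w) (iss_point A B) = trace (word_eval A B (letters w))"
  by (simp add: alg_trace)

lemma cyc_grad:
  "cyc A B l (letters w) =
     (\<Sum>i\<in>UNIV. mat (grad (alg_trace (basis w)) i (iss_point A B)) ** cyc A B l (coord_word i))"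
proof -
  let ?g = "\<lambda>i. grad (alg_trace (basis w)) i (iss_point A B)"
  have z: "mat 0 ** M = 0" for M :: "complex^2^2"
    by (simp add: mat2_simps)
  have tz: "trace (0 ** M) = 0" for M :: "complex^2^2"
    by (simp add: trace_def matrix_matrix_mult_def)
  have *: "trace (dword A B C E (letters w)) = (\<Sum>i\<in>UNIV. ?g i * trace (dword A B C E (coord_word i)))" for C E
  proof -
    let ?\<gamma> = "\<lambda>i s. trace (word_eval (A + mat s ** C) (B + mat s ** E) (coord_word i))"
    have "((\<lambda>s. alg_trace (basis w) (\<chi> i. ?\<gamma> i s)) has_field_derivative
        (\<Sum>i\<in>UNIV. grad (alg_trace (basis w)) i (\<chi> i. ?\<gamma> i 0) * trace (dword A B C E (coord_word i)))) (at 0)"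
      by (intro is_gradD grad_is_grad alg_trace trace_deriv)
    hence "((\<lambda>s. trace (word_eval (A + mat s ** C) (B + mat s ** E) (letters w))) has_field_derivative
        (\<Sum>i\<in>UNIV. ?g i * trace (dword A B C E (coord_word i)))) (at 0)"
      unfolding iss_point_coord[symmetric] alg_trace_basis by (simp add: z)
    thus ?thesis by (rule DERIV_unique[OF trace_deriv])
  qed
  have tm: "trace (M ** (mat c ** N)) = c * trace (M ** N)" for c and M N :: "complex^2^2"
    by (simp add: mat2_simps algebra_simps)
  show ?thesis
  proof (rule trace_nondegenerate)
    fix C
    show "trace (C ** cyc A B l (letters w)) =
       trace (C ** (\<Sum>i\<in>UNIV. mat (?g i) ** cyc A B l (coord_word i)))"
      using *[of C 0] *[of 0 C] unfolding trace_dword_cyc trace_mult_sum tm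
      by (cases l) (simp_all add: tz trace_zero)
  qed
qed

lemma trace_mult_sums:
  fixes X Y :: "'i \<Rightarrow> complex^2^2"
  shows "trace ((\<Sum>i\<in>S. mat (g i) ** X i) ** (\<Sum>j\<in>T. mat (h j) ** Y j)) =
    (\<Sum>i\<in>S. \<Sum>j\<in>T. g i * h j * trace (X i ** Y j))"
proof -
  have tm: "trace (M ** (mat c ** N)) = c * trace (M ** N)" for c and M N :: "complex^2^2"
    by (simp add: mat2_simps algebra_simps)
  have "trace ((\<Sum>i\<in>S. mat (g i) ** X i) ** (\<Sum>j\<in>T. mat (h j) ** Y j)) =
     (\<Sum>j\<in>T. h j * (\<Sum>i\<in>S. g i * trace (Y j ** X i)))"
    unfolding trace_mult_sum tm by (simp only: trace_mul_sym[of "sum _ S"] trace_mult_sum tm)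
  also have "\<dots> = (\<Sum>i\<in>S. \<Sum>j\<in>T. g i * h j * trace (X i ** Y j))"
    unfolding sum_distrib_left by (subst sum.swap) (simp add: trace_mul_sym[of "Y _"] mult_ac)
  finally show ?thesis .
qed

lemma table_cyc:
  "table i j (iss_point A B) =
     trace (cyc A B Ltr_x (coord_word i) ** cyc A B Ltr_xs (coord_word j)) -
     trace (cyc A B Ltr_xs (coord_word i) ** cyc A B Ltr_x (coord_word j))"
proof -
  have "\<forall>i j. table i j (iss_point A B) =
     trace (cyc A B Ltr_x (coord_word i) ** cyc A B Ltr_xs (coord_word j)) -
     trace (cyc A B Ltr_xs (coord_word i) ** cyc A B Ltr_x (coord_word j))"
    unfolding forall_5
    by (simp add: table_def iss_point_def cyc_def coord_word_def lessThan_Suc)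
      (simp add: mat2_simps algebra_simps)
  thus ?thesis by blast
qed

lemma std_poisson_trace_basis:
  "std_poisson (alg_trace (basis u)) (alg_trace (basis v)) (iss_point A B) =
     trace (cyc A B Ltr_x (letters u) ** cyc A B Ltr_xs (letters v)) -
     trace (cyc A B Ltr_xs (letters u) ** cyc A B Ltr_x (letters v))"
  unfolding cyc_grad[of A B _ u] cyc_grad[of A B _ v] trace_mult_sums std_poisson_def table_cyc
  by (simp add: right_diff_distrib sum_subtractf)

lemma trace_rep_linear:
  "trace (rep_eval A B (a + b)) = trace (rep_eval A B a) + trace (rep_eval A B b)"
  "trace (rep_eval A B (scal c a)) = c * trace (rep_eval A B a)"
  "trace (rep_eval A B (sum f S)) = (\<Sum>s\<in>S. trace (rep_eval A B (f s)))"
proof -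
  show 1: "trace (rep_eval A B (a + b)) = trace (rep_eval A B a) + trace (rep_eval A B b)" for a b
    by (simp add: rep_eval_add trace_add)
  show "trace (rep_eval A B (scal c a)) = c * trace (rep_eval A B a)"
    unfolding rep_eval_scal by (simp add: mat2_simps algebra_simps)
  show "trace (rep_eval A B (sum f S)) = (\<Sum>s\<in>S. trace (rep_eval A B (f s)))"
    by (induction S rule: infinite_finite_induct) (simp_all add: 1, simp_all add: trace_def)
qed

lemma trace_word_bracket:
  "trace (rep_eval A B (mu (word_bracket u v))) =
     trace (cyc A B Ltr_x u ** cyc A B Ltr_xs v) - trace (cyc A B Ltr_xs u ** cyc A B Ltr_x v)"
proof -
  let ?U = "\<lambda>i. word_eval A B (drop (Suc i) u) ** word_eval A B (take i u)"
  let ?V = "\<lambda>j. word_eval A B (drop (Suc j) v) ** word_eval A B (take j v)"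
  have c: "trace (cyc A B l u ** cyc A B l' v) =
     (\<Sum>i<length u. \<Sum>j<length v. (if u ! i = l \<and> v ! j = l' then 1 else 0) * trace (?U i ** ?V j))" for l l'
  proof -
    have m: "cyc A B l u = (\<Sum>k<length u. mat (if u ! k = l then 1 else 0) **
       (word_eval A B (drop (Suc k) u) ** word_eval A B (take k u)))" for l u
      unfolding cyc_def by (intro sum.cong refl) (simp add: mat2_simps)
    show ?thesis unfolding m trace_mult_sums by (intro sum.cong refl) simp
  qed
  have "trace (rep_eval A B (mu (word_bracket u v))) =
     (\<Sum>i<length u. \<Sum>j<length v. letter_form (u ! i) (v ! j) *
       trace (word_eval A B (take j v @ drop (Suc i) u @ take i u @ drop (Suc j) v)))"
    unfolding word_bracket_def linear_pmD(6)[OF linear_mu] linear_pmD(2)[OF linear_mu] trace_rep_linear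
    by (simp add: plus_word_def)
  also have "\<dots> = (\<Sum>i<length u. \<Sum>j<length v. letter_form (u ! i) (v ! j) * trace (?U i ** ?V j))"
  proof (intro sum.cong refl arg_cong[of _ _ "(*) _"])
    fix i j
    show "trace (word_eval A B (take j v @ drop (Suc i) u @ take i u @ drop (Suc j) v)) = trace (?U i ** ?V j)"
      unfolding word_eval_append by (subst trace_mul_sym) (simp add: matrix_mul_assoc)
  qed
  also have "\<dots> = trace (cyc A B Ltr_x u ** cyc A B Ltr_xs v) - trace (cyc A B Ltr_xs u ** cyc A B Ltr_x v)"
    unfolding c sum_subtractf[symmetric] by (intro sum.cong refl) (auto simp: letter_form_def)
  finally show ?thesis .
qed

lemma alg_trace_linear:
  "alg_trace (a + b) = (\<lambda>\<rho>. alg_trace a \<rho> + alg_trace b \<rho>)"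
  "alg_trace (scal c a) = (\<lambda>\<rho>. c * alg_trace a \<rho>)"
  "alg_trace 0 = (\<lambda>_. 0)"
  by (auto intro!: trace_function_unique simp: alg_trace trace_rep_linear trace_zero)

lemma std_poisson_trace: "std_poisson (alg_trace a) (alg_trace b) = alg_trace (mu (dbl a b))"
proof -
  have d: "dbl = std_bracket"
    by (rule canonical_double_bracket_unique[OF canonical_double_bracket_dbl canonical_double_bracket_exists])
  have bb: "std_poisson (alg_trace (basis u)) (alg_trace (basis v)) = alg_trace (mu (dbl (basis u) (basis v)))" for u v
    by (rule trace_function_unique)
      (simp only: d std_bracket_basis alg_trace trace_word_bracket std_poisson_trace_basis)
  have b: "std_poisson (alg_trace (basis u)) (alg_trace b) = alg_trace (mu (dbl (basis u) b))" for u
    by (induction b rule: pm_induct)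
      (simp_all add: alg_trace_linear linear_pmD[OF dbl_linear(1)] linear_pmD[OF linear_mu] std_poisson_const
        std_poisson_add std_poisson_cmult alg_trace bb)
  have L: "std_poisson (\<lambda>_. 0) f = (\<lambda>_. 0)"
    "g \<in> regular \<Longrightarrow> std_poisson (\<lambda>\<rho>. c * g \<rho>) f = (\<lambda>\<rho>. c * std_poisson g f \<rho>)"
    "g \<in> regular \<Longrightarrow> h \<in> regular \<Longrightarrow>
       std_poisson (\<lambda>\<rho>. g \<rho> + h \<rho>) f = (\<lambda>\<rho>. std_poisson g f \<rho> + std_poisson h f \<rho>)" for c f g h
    unfolding std_poisson_antisym[of _ f]
    by (simp_all add: std_poisson_const std_poisson_cmult std_poisson_add)
  show ?thesis
    by (induction a rule: pm_induct)
      (simp_all add: alg_trace_linear linear_pmD[OF dbl_linear(2)] linear_pmD[OF linear_mu] L alg_trace b)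
qed

lemma necklace_poisson_exists: "necklace_poisson std_poisson"
  unfolding necklace_poisson_def
proof (intro conjI allI std_poisson)
  show "std_poisson (necklace_trace w1) (necklace_trace w2) = necklace_trace (necklace_bracket w1 w2)" for w1 w2
    by transfer (rule std_poisson_trace)
qed

end

theory Submission
  imports Defs
begin

text \<open>
  In the coordinates \<open>X, Y, E', F', H'\<close> the Poisson structure is the product of the constant
  symplectic structure of the \<open>(X, Y)\<close>-plane and the linear structure of the dual of \<open>sl\<^sub>2\<close>. Along an
  integral curve of a Hamiltonian field \<open>(E', F', H')\<close> solves a homogeneous linear differential
  equation, so that it stays zero or stays nonzero (Gronwall), and the Casimir element is constant.
  Conversely, the explicit flows of \<open>X\<close>, \<open>Y\<close>, \<open>E'\<close>, \<open>F'\<close>, \<open>H'\<close> join any two points that these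
  invariants do not separate. The flows of \<open>E'\<close>, \<open>F'\<close>, \<open>H'\<close> act on the dual of \<open>sl\<^sub>2\<close> through
  unipotent and diagonal matrices, so the same argument classifies the coadjoint orbits.
\<close>

section \<open>Orbits on coordinate triples\<close>

type_synonym triple = "complex \<times> complex \<times> complex"

text \<open>The classes are given by two invariants, the Casimir value and vanishing, rather than by
  a group action. The same relation can therefore be compared both with coadjoint orbits and with
  symplectic leaves.\<close>

definition same_orbit :: "triple \<Rightarrow> triple \<Rightarrow> bool" where
  "same_orbit = (\<lambda>(e, f, h) (e', f', h').
     h\<^sup>2 + 4 * e * f = h'\<^sup>2 + 4 * e' * f' \<and> ((e, f, h) = (0, 0, 0) \<longleftrightarrow> (e', f', h') = (0, 0, 0)))"

lemma same_orbit_refl: "same_orbit t t"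
  by (simp add: same_orbit_def split: prod.split)

lemma same_orbit_trans: "same_orbit s t \<Longrightarrow> same_orbit t u \<Longrightarrow> same_orbit s u"
  by (auto simp: same_orbit_def)

text \<open>Any nonzero triple with Casimir value c can be moved to the normal form
  \<open>(1, c / 4, 0)\<close>, and the zero triple is alone in its class. The relation
  \<open>R\<close> is abstract because it is instantiated twice: by conjugation and by chains of
  Hamiltonian segments.\<close>

lemma same_orbit_connected:
  assumes refl: "\<And>t. R t t" and sym: "\<And>s t. R s t \<Longrightarrow> R t s"
    and trans: "\<And>s t u. R s t \<Longrightarrow> R t u \<Longrightarrow> R s u"
    and flow_E: "\<And>e f h s. R (e, f, h) (e, f + s * h - s\<^sup>2 * e, h - 2 * s * e)"
    and flow_F: "\<And>e f h s. R (e, f, h) (e - s * h - s\<^sup>2 * f, f, h + 2 * s * f)"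
    and torus: "\<And>e f h r. r \<noteq> 0 \<Longrightarrow> R (e, f, h) (r * e, f / r, h)"
    and "same_orbit s t"
  shows "R s t"
proof -
  have normal: "R (e, f, h) (1, (h\<^sup>2 + 4 * e * f) / 4, 0)" if nz: "(e, f, h) \<noteq> (0, 0, 0)" for e f h
  proof -
    have E: "R (e, f, h) (1, (h\<^sup>2 + 4 * e * f) / 4, 0)" if "e \<noteq> 0" for e f h
    proof -
      \<comment> \<open>This time of the E-flow makes the third coordinate vanish; the torus element
        \<open>1 / e\<close> then normalises the first.\<close>
      define s where "s = h / (2 * e)"
      have h: "h = 2 * s * e" using that by (simp add: s_def)
      have "R (e, f, h) (e, f + s * h - s\<^sup>2 * e, 0)"
        using flow_E[of e f h s] h by simp
      have "(f + s * h - s\<^sup>2 * e) / (1 / e) = (h\<^sup>2 + 4 * e * f) / 4"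
        by (simp add: h power2_eq_square algebra_simps)
      moreover have "1 / e * e = 1" using that by simp
      moreover have "R (e, f + s * h - s\<^sup>2 * e, 0) (1 / e * e, (f + s * h - s\<^sup>2 * e) / (1 / e), 0)"
        using that by (intro torus) simp
      ultimately have "R (e, f + s * h - s\<^sup>2 * e, 0) (1, (h\<^sup>2 + 4 * e * f) / 4, 0)"
        by (simp only:)
      with \<open>R (e, f, h) (e, f + s * h - s\<^sup>2 * e, 0)\<close> show ?thesis by (rule trans)
    qed
    \<comment> \<open>An F-flow makes the first coordinate nonzero. If \<open>e = 0\<close>, the
      times 1 and -1 give \<open>- h - f\<close> and \<open>h - f\<close>, which vanish together
      only when \<open>f = h = 0\<close>.\<close>
    obtain s where s: "e - s * h - s\<^sup>2 * f \<noteq> 0"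
    proof (cases "e = 0")
      case True
      hence "e - 1 * h - 1\<^sup>2 * f \<noteq> 0 \<or> e - (-1) * h - (-1)\<^sup>2 * f \<noteq> 0"
        using nz by auto
      thus ?thesis using that by blast
    qed (use that[of 0] in auto)
    \<comment> \<open>The F-flow preserves the Casimir value, so the normal form reached afterwards
      is that of the original triple.\<close>
    have "(h + 2 * s * f)\<^sup>2 + 4 * (e - s * h - s\<^sup>2 * f) * f = h\<^sup>2 + 4 * e * f"
      by (simp add: power2_eq_square algebra_simps)
    thus ?thesis using trans[OF flow_F[of e f h s] E[OF s]] by metis
  qed
  obtain e f h e' f' h' where st: "s = (e, f, h)" "t = (e', f', h')"
    by (metis prod_cases3)
  show ?thesis
  proof (cases "s = (0, 0, 0)")
    case True
    thus ?thesis using assms(7) refl by (auto simp: same_orbit_def st)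
  next
    case False
    hence "(e, f, h) \<noteq> (0, 0, 0)" "(e', f', h') \<noteq> (0, 0, 0)"
      and eq: "h\<^sup>2 + 4 * e * f = h'\<^sup>2 + 4 * e' * f'"
      using assms(7) unfolding same_orbit_def st prod.case by blast+
    from normal[OF this(1)] normal[OF this(2)] show ?thesis
      unfolding st eq by (rule trans[OF _ sym])
  qed
qed

section \<open>Coadjoint orbits\<close>

definition dual_point :: "triple \<Rightarrow> (complex^2^2 \<Rightarrow> complex)" where
  "dual_point = (\<lambda>(e, f, h). \<lambda>a\<in>sl2. a$1$2 * e + a$2$1 * f + a$1$1 * h)"

lemma sl2_iff: "a \<in> sl2 \<longleftrightarrow> a$2$2 = - a$1$1"
  by (auto simp: sl2_def trace_def sum_2 eq_neg_iff_add_eq_0 add.commute)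

definition mat2 :: "complex \<Rightarrow> complex \<Rightarrow> complex \<Rightarrow> complex \<Rightarrow> complex^2^2" where
  "mat2 a b c d = vector [vector [a, b], vector [c, d]]"

lemma mat2_nth [simp]:
  "mat2 a b c d $ 1 $ 1 = a" "mat2 a b c d $ 1 $ 2 = b"
  "mat2 a b c d $ 2 $ 1 = c" "mat2 a b c d $ 2 $ 2 = d"
  by (simp_all add: mat2_def)

lemma mat2_eta: "mat2 (a$1$1) (a$1$2) (a$2$1) (a$2$2) = a"
  by (simp add: vec_eq_iff forall_2)

lemma dual_point_inject: "dual_point s = dual_point t \<longleftrightarrow> s = t"
proof
  assume eq: "dual_point s = dual_point t"
  obtain e f h e' f' h' where st: "s = (e, f, h)" "t = (e', f', h')"
    by (metis prod_cases3)
  show "s = t"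
    \<comment> \<open>Evaluation at the standard basis e, f, h reads off the three
      coordinates.\<close>
    using fun_cong[OF eq, of "mat2 0 1 0 0"] fun_cong[OF eq, of "mat2 0 0 1 0"]
      fun_cong[OF eq, of "mat2 1 0 0 (- 1)"]
    by (simp add: dual_point_def sl2_iff st)
qed simp

lemma sl2_dual_eq: "sl2_dual = range dual_point"
proof (intro equalityI subsetI)
  fix \<xi> assume "\<xi> \<in> sl2_dual"
  hence ext: "\<xi> \<in> extensional sl2"
    and add: "\<And>a b. a \<in> sl2 \<Longrightarrow> b \<in> sl2 \<Longrightarrow> \<xi> (a + b) = \<xi> a + \<xi> b"
    and scal: "\<And>c a. a \<in> sl2 \<Longrightarrow> \<xi> (mat c ** a) = c * \<xi> a"
    by (auto simp: sl2_dual_def)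
  let ?e = "mat2 0 1 0 0" and ?f = "mat2 0 0 1 0" and ?h = "mat2 1 0 0 (- 1)"
  have "\<xi> = dual_point (\<xi> ?e, \<xi> ?f, \<xi> ?h)"
  proof (rule extensionalityI[OF ext])
    show "dual_point (\<xi> ?e, \<xi> ?f, \<xi> ?h) \<in> extensional sl2" by (simp add: dual_point_def)
    fix a :: "complex^2^2" assume a: "a \<in> sl2"
    \<comment> \<open>Additivity of \<open>\<xi>\<close> holds only inside \<open>sl2\<close>, so
      the partial sum must be shown traceless as well.\<close>
    have mem: "mat (a$1$2) ** ?e \<in> sl2" "mat (a$2$1) ** ?f \<in> sl2" "mat (a$1$1) ** ?h \<in> sl2"
      "mat (a$1$2) ** ?e + mat (a$2$1) ** ?f \<in> sl2" "?e \<in> sl2" "?f \<in> sl2" "?h \<in> sl2"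
      by (simp_all add: sl2_iff mat2_simps)
    have "a = mat (a$1$2) ** ?e + mat (a$2$1) ** ?f + mat (a$1$1) ** ?h"
      using a by (simp add: sl2_iff mat2_simps)
    hence "\<xi> a = \<xi> (mat (a$1$2) ** ?e + mat (a$2$1) ** ?f + mat (a$1$1) ** ?h)" by simp
    thus "\<xi> a = dual_point (\<xi> ?e, \<xi> ?f, \<xi> ?h) a"
      using a by (simp add: add scal mem dual_point_def)
  qed
  thus "\<xi> \<in> range dual_point" by blast
next
  fix \<xi> assume "\<xi> \<in> range dual_point"
  then obtain e f h where "\<xi> = dual_point (e, f, h)" by auto
  thus "\<xi> \<in> sl2_dual"
    by (auto simp: sl2_dual_def dual_point_def sl2_iff mat2_simps algebra_simps)
qed

text \<open>The functional with coordinates \<open>(e, f, h)\<close> is the trace pairing with the matrix with rows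
  \<open>(h/2, f)\<close> and \<open>(e, -h/2)\<close>; the triple below is read off its conjugate by \<open>(a, b; c, d)\<close>.\<close>

definition conj_triple :: "complex \<Rightarrow> complex \<Rightarrow> complex \<Rightarrow> complex \<Rightarrow> triple \<Rightarrow> triple" where
  "conj_triple a b c d = (\<lambda>(e, f, h). (d\<^sup>2 * e - c\<^sup>2 * f + c * d * h, a\<^sup>2 * f - b\<^sup>2 * e - a * b * h,
     (a * d + b * c) * h + 2 * b * d * e - 2 * a * c * f))"

lemma matrix_inv_mat2:
  assumes "a * d - b * c = 1"
  shows "matrix_inv (mat2 a b c d) = mat2 d (- b) (- c) a"
proof -
  let ?g = "mat2 a b c d" and ?k = "mat2 d (- b) (- c) a"
  have k: "?g ** ?k = mat 1" "?k ** ?g = mat 1"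
    using assms by (simp_all add: mat2_simps algebra_simps)
  hence "?g ** matrix_inv ?g = mat 1"
    unfolding matrix_inv_def by (metis (mono_tags, lifting) someI_ex)
  \<comment> \<open>\<open>matrix_inv\<close> is a choice among two-sided inverses; cancelling on
    the left identifies it with the adjugate.\<close>
  hence "?k ** (?g ** matrix_inv ?g) = ?k" by simp
  thus ?thesis by (simp add: matrix_mul_assoc k)
qed

lemma coadjoint_dual_point:
  assumes "a * d - b * c = 1"
  shows "coadjoint (mat2 a b c d) (dual_point t) = dual_point (conj_triple a b c d t)"
proof -
  obtain e f h where t: "t = (e, f, h)" by (metis prod_cases3)
  show ?thesis
    unfolding coadjoint_def matrix_inv_mat2[OF assms] t
  proof (rule extensionalityI[of _ sl2])
    fix m :: "complex^2^2" assume m: "m \<in> sl2"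
    let ?n = "mat2 d (- b) (- c) a ** m ** mat2 a b c d"
    have "?n \<in> sl2"
      using m by (simp add: sl2_iff mat2_simps algebra_simps)
    thus "(\<lambda>m\<in>sl2. dual_point (e, f, h) (mat2 d (- b) (- c) a ** m ** mat2 a b c d)) m =
        dual_point (conj_triple a b c d (e, f, h)) m"
      using m by (simp add: dual_point_def conj_triple_def sl2_iff mat2_simps power2_eq_square algebra_simps)
  qed (auto simp: dual_point_def split: prod.split)
qed

text \<open>This is the action law for the matrix product. It is a polynomial identity in the
  entries, valid for every determinant.\<close>

lemma conj_triple_comp:
  "conj_triple a b c d (conj_triple a' b' c' d' t) =
     conj_triple (a * a' + b * c') (a * b' + b * d') (c * a' + d * c') (c * b' + d * d') t"
  by (auto simp: conj_triple_def power2_eq_square algebra_simps split: prod.split)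

lemma conj_triple_id: "conj_triple 1 0 0 1 t = t"
  by (simp add: conj_triple_def split: prod.split)

lemma conj_triple_same_orbit:
  assumes "a * d - b * c = 1"
  shows "same_orbit t (conj_triple a b c d t)"
proof -
  obtain e f h where t: "t = (e, f, h)" by (metis prod_cases3)
  obtain e' f' h' where t': "conj_triple a b c d t = (e', f', h')" by (metis prod_cases3)
  \<comment> \<open>The adjugate undoes the action, so a triple vanishes exactly when its image
    does.\<close>
  have "conj_triple d (- b) (- c) a (conj_triple a b c d t) = t"
    unfolding conj_triple_comp using assms conj_triple_id[of t]
    by (simp add: algebra_simps)
  moreover have "conj_triple a b c d (0, 0, 0) = (0, 0, 0)" for a b c d
    by (simp add: conj_triple_def)
  ultimately have "t = (0, 0, 0) \<longleftrightarrow> conj_triple a b c d t = (0, 0, 0)"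
    by metis
  \<comment> \<open>The Casimir value is -4 times the determinant of the matrix that represents the
    functional. Multiplying that matrix by g on the left and by the adjugate of g on the right
    scales its determinant by the square of det g.\<close>
  moreover have "h'\<^sup>2 + 4 * e' * f' = (a * d - b * c)\<^sup>2 * (h\<^sup>2 + 4 * e * f)"
  proof -
    have "e' = d\<^sup>2 * e - c\<^sup>2 * f + c * d * h" "f' = a\<^sup>2 * f - b\<^sup>2 * e - a * b * h"
      "h' = (a * d + b * c) * h + 2 * b * d * e - 2 * a * c * f"
      using t' by (simp_all add: conj_triple_def t)
    thus ?thesis by (simp only:) (simp add: power2_eq_square algebra_simps)
  qed
  ultimately show ?thesis
    using assms unfolding t' by (simp add: same_orbit_def t)
qed

lemma same_orbit_conj_triple:
  assumes "same_orbit s t"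
  shows "\<exists>a b c d. a * d - b * c = 1 \<and> t = conj_triple a b c d s"
proof (rule same_orbit_connected[OF _ _ _ _ _ _ assms,
      of "\<lambda>s t. \<exists>a b c d. a * d - b * c = 1 \<and> t = conj_triple a b c d s"])
  let ?R = "\<lambda>s t. \<exists>a b c d. a * d - b * c = 1 \<and> t = conj_triple a b c d s"
  have I: "?R s t" if "a * d - b * c = 1" "conj_triple a b c d s = t" for a b c d s t
    using that by blast
  show "?R t t" for t
    \<comment> \<open>The instantiation order of \<open>I\<close> is a, d, b, c, the order of
      occurrence in the determinant condition.\<close>
    by (rule I[of 1 1 0 0]) (simp_all add: conj_triple_id)
  show "?R t s" if "?R s t" for s t
  proof -
    from that obtain a b c d where g: "a * d - b * c = 1" "t = conj_triple a b c d s" by blast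
    show ?thesis
      using g(1) conj_triple_id[of s]
      by (intro I[of d a "- b" "- c"]) (simp_all add: g(2) conj_triple_comp algebra_simps)
  qed
  show "?R s u" if "?R s t" "?R t u" for s t u
  proof -
    from that obtain a b c d a' b' c' d' where
      g: "a * d - b * c = 1" "t = conj_triple a b c d s" "a' * d' - b' * c' = 1" "u = conj_triple a' b' c' d' t"
      by blast
    have "(a' * a + b' * c) * (c' * b + d' * d) - (a' * b + b' * d) * (c' * a + d' * c) =
        (a * d - b * c) * (a' * d' - b' * c')"
      by (simp add: algebra_simps)
    thus ?thesis using g by (intro I) (auto simp: conj_triple_comp)
  qed
  \<comment> \<open>The E- and F-flows come from the upper and the lower unipotent matrix with
    off-diagonal entry \<open>- s\<close>.\<close>
  show "?R (e, f, h) (e, f + s * h - s\<^sup>2 * e, h - 2 * s * e)" for e f h s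
    by (rule I[of 1 1 "- s" 0]) (simp_all add: conj_triple_def)
  show "?R (e, f, h) (e - s * h - s\<^sup>2 * f, f, h + 2 * s * f)" for e f h s
    by (rule I[of 1 1 0 "- s"]) (simp_all add: conj_triple_def)
  show "?R (e, f, h) (r * e, f / r, h)" if "r \<noteq> 0" for e f h r
  \<comment> \<open>The first coordinate scales by the square of the lower diagonal entry, hence the
    square root.\<close>
  proof (rule I[of "1 / csqrt r" "csqrt r" 0 0])
    show "conj_triple (1 / csqrt r) 0 0 (csqrt r) (e, f, h) = (r * e, f / r, h)"
      using that by (simp add: conj_triple_def power_divide)
  qed (use that in simp)
qed

lemma coadjoint_orbit_dual_point: "coadjoint_orbit (dual_point s) = dual_point ` {t. same_orbit s t}"
proof (intro equalityI subsetI)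
  fix \<xi> assume "\<xi> \<in> coadjoint_orbit (dual_point s)"
  then obtain g where g: "det g = 1" "\<xi> = coadjoint g (dual_point s)"
    by (auto simp: coadjoint_orbit_def)
  have "g$1$1 * g$2$2 - g$1$2 * g$2$1 = 1" using g(1) by (simp add: det_2)
  from coadjoint_dual_point[OF this] conj_triple_same_orbit[OF this]
  show "\<xi> \<in> dual_point ` {t. same_orbit s t}" unfolding g(2) mat2_eta by blast
next
  fix \<xi> assume "\<xi> \<in> dual_point ` {t. same_orbit s t}"
  then obtain a b c d where g: "a * d - b * c = 1" "\<xi> = dual_point (conj_triple a b c d s)"
    using same_orbit_conj_triple by blast
  have "det (mat2 a b c d) = 1" using g(1) by (simp add: det_2)
  thus "\<xi> \<in> coadjoint_orbit (dual_point s)"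
    unfolding g(2) coadjoint_orbit_def coadjoint_dual_point[OF g(1), symmetric] by blast
qed


section \<open>The Poisson structure in coordinates\<close>

text \<open>Every coordinate is a trace function, so the necklace condition determines all brackets
  of coordinates.\<close>

lemma coord_alg_trace: "(\<lambda>\<rho>. \<rho> $ i) = alg_trace (basis (Word (coord_word i)))"
  by (rule trace_function_unique) (simp only: alg_trace_basis, simp add: iss_point_coord)

lemma necklace_poisson_trace:
  assumes "necklace_poisson P"
  shows "P (alg_trace a) (alg_trace b) = alg_trace (mu (dbl a b))"
proof -
  have "P (necklace_trace (abs_necklace a)) (necklace_trace (abs_necklace b)) =
      necklace_trace (necklace_bracket (abs_necklace a) (abs_necklace b))"
    using assms by (simp add: necklace_poisson_def)
  thus ?thesis by (simp add: necklace_trace.abs_eq necklace_bracket.abs_eq)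
qed

lemma poisson_bracketD:
  assumes "poisson_bracket P" "f \<in> regular" "g \<in> regular" "h \<in> regular"
  shows "P f (\<lambda>\<rho>. g \<rho> + h \<rho>) = (\<lambda>\<rho>. P f g \<rho> + P f h \<rho>)"
    and "P f (\<lambda>\<rho>. c * g \<rho>) = (\<lambda>\<rho>. c * P f g \<rho>)"
    and "P f g = (\<lambda>\<rho>. - P g f \<rho>)"
    and "P f (\<lambda>\<rho>. g \<rho> * h \<rho>) = (\<lambda>\<rho>. P f g \<rho> * h \<rho> + g \<rho> * P f h \<rho>)"
  using assms unfolding poisson_bracket_def by blast+

lemma poisson_bracket_const:
  assumes "poisson_bracket P" "f \<in> regular"
  shows "P f (\<lambda>_. c) = (\<lambda>_. 0)"
proof -
  \<comment> \<open>The Leibniz rule for \<open>1 * 1\<close> says that this bracket equals twice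
    itself.\<close>
  have "P f (\<lambda>_. 1) = (\<lambda>_. 0)"
    using poisson_bracketD(4)[OF assms regular.const[of 1] regular.const[of 1]]
    by (simp add: fun_eq_iff)
  thus ?thesis using poisson_bracketD(2)[OF assms regular.const[of 1] regular.const[of 1], of c] by simp
qed

text \<open>The trace condition settles brackets of two coordinates, and the Leibniz rule extends
  this to regular \<open>f\<close>. Hamiltonian fields pair \<open>f\<close> only with coordinates,
  so from here on an arbitrary \<open>P\<close> is governed by the explicit table.\<close>

lemma necklace_poisson_coord:
  assumes P: "necklace_poisson P" and f: "f \<in> regular"
  shows "P f (\<lambda>\<rho>. \<rho> $ i) = std_poisson f (\<lambda>\<rho>. \<rho> $ i)"
proof -
  have pb: "poisson_bracket P" using P by (simp add: necklace_poisson_def)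
  note c = regular.coord[of i]
  have "P (\<lambda>\<rho>. \<rho> $ i) f = std_poisson (\<lambda>\<rho>. \<rho> $ i) f"
    using f
  proof (induction rule: regular.induct)
    case (const c)
    show ?case using poisson_bracket_const[OF pb c] std_poisson_const by simp
  next
    case (coord k)
    show ?case unfolding coord_alg_trace necklace_poisson_trace[OF P] std_poisson_trace ..
  next
    case (add f g)
    thus ?case by (simp add: poisson_bracketD(1)[OF pb c add.hyps] std_poisson_add)
  next
    case (mult f g)
    thus ?case by (simp add: poisson_bracketD(4)[OF pb c mult.hyps] std_poisson_mult)
  qed
  thus ?thesis
    using poisson_bracketD(3)[OF pb f c f] std_poisson_antisym[of f] by simp
qed

lemma hamiltonian_field_nth:
  assumes "necklace_poisson P" "f \<in> regular"
  shows "hamiltonian_field P f \<rho> $ i = (\<Sum>k\<in>UNIV. grad f k \<rho> * table k i \<rho>)"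
proof -
  have "(\<Sum>j\<in>UNIV. grad f k \<rho> * (if j = i then 1 else 0) * table k j \<rho>) = grad f k \<rho> * table k i \<rho>" for k
    by (simp add: if_distrib[of "\<lambda>x. _ * x"] if_distrib[of "\<lambda>x. x * _"] cong: if_cong)
  thus ?thesis
    by (simp add: hamiltonian_field_def necklace_poisson_coord[OF assms] std_poisson_def grad_coord)
qed

lemma field_coords:
  assumes "necklace_poisson P" "f \<in> regular"
  shows "hamiltonian_field P f \<rho> $ 1 =
      - 2 * grad f 2 \<rho> - 2 * \<rho>$2 * grad f 4 \<rho> - \<rho>$1 * grad f 5 \<rho>"
    and "hamiltonian_field P f \<rho> $ 2 =
      2 * grad f 1 \<rho> + 2 * \<rho>$1 * grad f 3 \<rho> + \<rho>$2 * grad f 5 \<rho>"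
    and "hamiltonian_field P f \<rho> $ 3 =
      - 2 * \<rho>$1 * grad f 2 \<rho> - 4 * \<rho>$5 * grad f 4 \<rho> - 2 * \<rho>$3 * grad f 5 \<rho>"
    and "hamiltonian_field P f \<rho> $ 4 =
      2 * \<rho>$2 * grad f 1 \<rho> + 4 * \<rho>$5 * grad f 3 \<rho> + 2 * \<rho>$4 * grad f 5 \<rho>"
    and "hamiltonian_field P f \<rho> $ 5 =
      \<rho>$1 * grad f 1 \<rho> - \<rho>$2 * grad f 2 \<rho> + 2 * \<rho>$3 * grad f 3 \<rho> - 2 * \<rho>$4 * grad f 4 \<rho>"
  by (simp_all add: hamiltonian_field_nth[OF assms] sum_5 table_def)

lemma generators:
  "fH \<rho> = \<rho> $ 5" "fF \<rho> = - (\<rho> $ 3 / 2)" "fE \<rho> = \<rho> $ 4 / 2" "fX \<rho> = \<rho> $ 2" "fY \<rho> = - \<rho> $ 1"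
proof -
  have c: "alg_trace (basis (Word (coord_word i))) \<rho> = \<rho> $ i" for i
    by (simp flip: coord_alg_trace)
  show "fH \<rho> = \<rho> $ 5" "fF \<rho> = - (\<rho> $ 3 / 2)" "fE \<rho> = \<rho> $ 4 / 2" "fX \<rho> = \<rho> $ 2" "fY \<rho> = - \<rho> $ 1"
    using c[of 1] c[of 2] c[of 3] c[of 4] c[of 5]
    by (simp_all add: fH_def fF_def fE_def fX_def fY_def gx_def gxs_def coord_word_def mult_single plus_word_def)
qed

lemma sl2_coords:
  "E' \<rho> = \<rho>$4 / 2 - \<rho>$2 * \<rho>$2 / 4" "F' \<rho> = - (\<rho>$3 / 2) + \<rho>$1 * \<rho>$1 / 4"
  "H' \<rho> = \<rho>$5 - \<rho>$1 * \<rho>$2 / 2"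
  by (simp_all add: E'_def F'_def H'_def generators power2_eq_square)

text \<open>The point with coordinates \<open>X = x\<close>, \<open>Y = y\<close>, \<open>E' = e\<close>, \<open>F' = f\<close>, \<open>H' = h\<close>.\<close>

definition iss_pt :: "complex \<Rightarrow> complex \<Rightarrow> triple \<Rightarrow> complex^5" where
  "iss_pt x y = (\<lambda>(e, f, h).
     vector [- y, x, y * y / 2 - 2 * f, x * x / 2 + 2 * e, h - x * y / 2])"

definition triple_of :: "complex^5 \<Rightarrow> triple" where
  "triple_of \<rho> = (E' \<rho>, F' \<rho>, H' \<rho>)"

lemma iss_pt_nth: "iss_pt x y t $ 1 = - y" "iss_pt x y t $ 2 = x"
  by (simp_all add: iss_pt_def split: prod.split)

lemma triple_of_iss_pt [simp]: "triple_of (iss_pt x y t) = t"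
  by (auto simp: triple_of_def iss_pt_def sl2_coords field_simps split: prod.split)

text \<open>Together with \<open>triple_of_iss_pt\<close> and \<open>iss_pt_nth\<close>, this makes
  \<open>X, Y, E', F', H'\<close> global coordinates on the variety.\<close>

lemma iss_pt_triple_of: "iss_pt (\<rho>$2) (- \<rho>$1) (triple_of \<rho>) = \<rho>"
  unfolding vec_eq_iff forall_5 by (simp add: triple_of_def iss_pt_def sl2_coords)

lemma sl2_map_eq: "sl2_map \<rho> = dual_point (triple_of \<rho>)"
  by (simp add: sl2_map_def dual_point_def triple_of_def)

section \<open>Invariants of the leaves\<close>

text \<open>Gronwall's argument: by Cauchy-Schwarz, the squared norm of \<open>y\<close> damped by
  \<open>exp (- 2 * C * t)\<close> is nonincreasing. It starts at zero and is nonnegative, so it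
  ends at zero.\<close>

lemma linear_growth_zero:
  fixes y :: "real \<Rightarrow> 'a::real_inner"
  assumes "a \<le> b" and y: "\<And>t. t \<in> {a..b} \<Longrightarrow> (y has_vector_derivative y' t) (at t within {a..b})"
    and C: "\<And>t. t \<in> {a..b} \<Longrightarrow> norm (y' t) \<le> C * norm (y t)" and "y a = 0"
  shows "y b = 0"
proof -
  let ?\<phi> = "\<lambda>t. exp (- 2 * C * t) * (y t \<bullet> y t)"
  let ?\<phi>' = "\<lambda>t. 2 * exp (- 2 * C * t) * (y t \<bullet> y' t - C * (y t \<bullet> y t))"
  have D: "(?\<phi> has_real_derivative ?\<phi>' t) (at t within {a..b})" if "t \<in> {a..b}" for t
  proof -
    have "((\<lambda>t. y t \<bullet> y t) has_derivative (\<lambda>h. y t \<bullet> (h *\<^sub>R y' t) + (h *\<^sub>R y' t) \<bullet> y t)) (at t within {a..b})"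
      using y[OF that] by (intro has_derivative_inner) (simp_all add: has_vector_derivative_def)
    hence "((\<lambda>t. y t \<bullet> y t) has_real_derivative 2 * (y t \<bullet> y' t)) (at t within {a..b})"
      unfolding has_field_derivative_def by (rule has_derivative_eq_rhs) (auto simp: inner_commute fun_eq_iff)
    thus ?thesis by (auto intro!: derivative_eq_intros simp: algebra_simps)
  qed
  have le: "?\<phi>' t \<le> 0" if "t \<in> {a..b}" for t
  proof -
    have "y t \<bullet> y' t \<le> norm (y t) * norm (y' t)" by (rule norm_cauchy_schwarz)
    also have "\<dots> \<le> norm (y t) * (C * norm (y t))" using C[OF that] by (intro mult_left_mono) auto
    also have "\<dots> = C * (y t \<bullet> y t)" by (simp add: dot_square_norm power2_eq_square)
    finally show ?thesis by (simp add: mult_nonneg_nonpos)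
  qed
  have "?\<phi> b \<le> ?\<phi> a"
  proof (intro DERIV_nonpos_imp_decreasing_open[OF \<open>a \<le> b\<close>])
    show "continuous_on {a..b} ?\<phi>"
      using D by (intro DERIV_continuous_on)
    show "\<exists>y. (?\<phi> has_real_derivative y) (at t) \<and> y \<le> 0" if "a < t" "t < b" for t
      using D[of t] le[of t] that by (auto simp: at_within_Icc_at)
  qed
  thus ?thesis using \<open>y a = 0\<close> by (simp add: mult_le_0_iff dot_square_norm)
qed

lemma regular_continuous: "f \<in> regular \<Longrightarrow> continuous_on S f"
  by (induction rule: regular.induct) (auto intro: continuous_intros)

text \<open>\<open>E'\<close>, \<open>F'\<close>, \<open>H'\<close> Poisson commute with
  \<open>X\<close> and \<open>Y\<close>, so the partial derivatives of \<open>f\<close> in the first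
  two coordinates cancel. What remains is linear and homogeneous in the triple.\<close>

lemma segment_triple_deriv:
  assumes P: "necklace_poisson P" and f: "f \<in> regular"
    and \<gamma>: "(\<gamma> has_vector_derivative hamiltonian_field P f (\<gamma> t)) (at t within S)"
  defines "u \<equiv> grad f 3 (\<gamma> t)" and "v \<equiv> grad f 4 (\<gamma> t)" and "w \<equiv> grad f 5 (\<gamma> t)"
  shows "((\<lambda>t. E' (\<gamma> t)) has_vector_derivative 2 * u * H' (\<gamma> t) + 2 * w * E' (\<gamma> t)) (at t within S)"
    and "((\<lambda>t. F' (\<gamma> t)) has_vector_derivative 2 * v * H' (\<gamma> t) - 2 * w * F' (\<gamma> t)) (at t within S)"
    and "((\<lambda>t. H' (\<gamma> t)) has_vector_derivative - 4 * u * F' (\<gamma> t) - 4 * v * E' (\<gamma> t)) (at t within S)"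
proof -
  have "((\<lambda>t. \<gamma> t $ i) has_vector_derivative hamiltonian_field P f (\<gamma> t) $ i) (at t within S)" for i
    by (rule bounded_linear.has_vector_derivative[OF bounded_linear_vec_nth \<gamma>])
  note d = this[of 1] this[of 2] this[of 3] this[of 4] this[of 5]
  note d = d[unfolded field_coords[OF P f]]
  show "((\<lambda>t. E' (\<gamma> t)) has_vector_derivative 2 * u * H' (\<gamma> t) + 2 * w * E' (\<gamma> t)) (at t within S)"
    unfolding sl2_coords u_def v_def w_def
    by (rule derivative_eq_intros d refl)+ (simp add: field_simps)
  show "((\<lambda>t. F' (\<gamma> t)) has_vector_derivative 2 * v * H' (\<gamma> t) - 2 * w * F' (\<gamma> t)) (at t within S)"
    unfolding sl2_coords u_def v_def w_def
    by (rule derivative_eq_intros d refl)+ (simp add: field_simps)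
  show "((\<lambda>t. H' (\<gamma> t)) has_vector_derivative - 4 * u * F' (\<gamma> t) - 4 * v * E' (\<gamma> t)) (at t within S)"
    unfolding sl2_coords u_def v_def w_def
    by (rule derivative_eq_intros d refl)+ (simp add: field_simps)
qed

section \<open>Norm bounds, time reversal and invariance along a segment\<close>

lemma norm_triple_le:
  fixes a b c :: complex
  shows "norm (a, b, c) \<le> norm a + norm b + norm c"
  using norm_Pair_le[of a "(b, c)"] norm_Pair_le[of b c] by simp

lemma norm_triple_ge:
  fixes a b c :: complex
  shows "norm a \<le> norm (a, b, c)" "norm b \<le> norm (a, b, c)" "norm c \<le> norm (a, b, c)"
  using norm_fst_le[of a "(b, c)"] norm_snd_le[of "(b, c)" a] norm_fst_le[of b c] norm_snd_le[of c b]
  by linarith+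

text \<open>Replacing the Hamiltonian by its negative reverses the curve in time.\<close>

lemma hamiltonian_segment_sym:
  assumes P: "necklace_poisson P" and "hamiltonian_segment P \<rho> \<sigma>"
  shows "hamiltonian_segment P \<sigma> \<rho>"
proof -
  from assms(2) obtain f \<gamma> a b where f: "f \<in> regular" and ab: "a \<le> b"
    and \<gamma>: "\<And>t. t \<in> {a..b} \<Longrightarrow> (\<gamma> has_vector_derivative hamiltonian_field P f (\<gamma> t)) (at t within {a..b})"
    and ends: "\<gamma> a = \<rho>" "\<gamma> b = \<sigma>"
    unfolding hamiltonian_segment_def by blast
  have nf: "grad (\<lambda>\<rho>. - 1 * f \<rho>) i \<rho> = - grad f i \<rho>" for i \<rho>
    by (simp only: grad_mult[OF regular.const f regular.const f] grad_const) simp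
  have reg: "(\<lambda>\<rho>. - 1 * f \<rho>) \<in> regular" by (intro regular.intros f)
  have neg: "hamiltonian_field P (\<lambda>\<rho>. - 1 * f \<rho>) \<rho> = - hamiltonian_field P f \<rho>" for \<rho>
    unfolding vec_eq_iff
    by (simp only: hamiltonian_field_nth[OF P reg] hamiltonian_field_nth[OF P f] nf vector_uminus_component)
      (simp add: sum_negf)
  have "((\<lambda>t. \<gamma> (- t)) has_vector_derivative hamiltonian_field P (\<lambda>\<rho>. - 1 * f \<rho>) (\<gamma> (- t)))
      (at t within {- b..- a})" if "t \<in> {- b..- a}" for t
  proof -
    have "(uminus has_vector_derivative - 1) (at t within {- b..- a})"
      by (auto intro!: derivative_eq_intros)
    moreover have "(\<gamma> has_vector_derivative hamiltonian_field P f (\<gamma> (- t))) (at (- t) within uminus ` {- b..- a})"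
      using \<gamma>[of "- t"] that by simp
    ultimately have "(\<gamma> \<circ> uminus has_vector_derivative (- 1) *\<^sub>R hamiltonian_field P f (\<gamma> (- t)))
        (at t within {- b..- a})"
      by (rule vector_diff_chain_within)
    thus ?thesis unfolding neg by (simp add: o_def)
  qed
  thus ?thesis
    unfolding hamiltonian_segment_def using ab ends
    by (intro bexI[OF _ reg] exI[of _ "\<lambda>t. \<gamma> (- t)"] exI[of _ "- b"] exI[of _ "- a"]) auto
qed

lemma segment_zero:
  assumes P: "necklace_poisson P" and "hamiltonian_segment P \<rho> \<sigma>" and "triple_of \<rho> = (0, 0, 0)"
  shows "triple_of \<sigma> = (0, 0, 0)"
proof -
  from assms(2) obtain f \<gamma> a b where f: "f \<in> regular" and ab: "a \<le> b"
    and \<gamma>: "\<And>t. t \<in> {a..b} \<Longrightarrow> (\<gamma> has_vector_derivative hamiltonian_field P f (\<gamma> t)) (at t within {a..b})"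
    and ends: "\<gamma> a = \<rho>" "\<gamma> b = \<sigma>"
    unfolding hamiltonian_segment_def by blast
  have cont: "continuous_on {a..b} \<gamma>"
    unfolding continuous_on_eq_continuous_within using \<gamma> by (blast intro: has_vector_derivative_continuous)
  \<comment> \<open>Gradients of regular functions are continuous, hence bounded along the compact
    curve; these bounds control the coefficients of the linear equation.\<close>
  have "\<exists>K. \<forall>t\<in>{a..b}. norm (grad f i (\<gamma> t)) \<le> K" for i
  proof -
    have "continuous_on {a..b} (\<lambda>t. grad f i (\<gamma> t))"
      using continuous_on_compose[OF cont regular_continuous[OF grad_regular[OF f]]] by (simp add: o_def)
    from compact_continuous_image[OF this compact_Icc] have "bounded ((\<lambda>t. grad f i (\<gamma> t)) ` {a..b})"
      by (rule compact_imp_bounded)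
    thus ?thesis by (auto simp: bounded_iff)
  qed
  then obtain K where K: "\<And>i t. t \<in> {a..b} \<Longrightarrow> norm (grad f i (\<gamma> t)) \<le> K i" by metis
  define L where "L = \<bar>K 3\<bar> + \<bar>K 4\<bar> + \<bar>K 5\<bar>"
  let ?y = "\<lambda>t. triple_of (\<gamma> t)"
  let ?y' = "\<lambda>t. (2 * grad f 3 (\<gamma> t) * H' (\<gamma> t) + 2 * grad f 5 (\<gamma> t) * E' (\<gamma> t),
    2 * grad f 4 (\<gamma> t) * H' (\<gamma> t) - 2 * grad f 5 (\<gamma> t) * F' (\<gamma> t),
    - 4 * grad f 3 (\<gamma> t) * F' (\<gamma> t) - 4 * grad f 4 (\<gamma> t) * E' (\<gamma> t))"
  have "?y b = 0"
  proof (rule linear_growth_zero[OF ab])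
    fix t assume t: "t \<in> {a..b}"
    show "(?y has_vector_derivative ?y' t) (at t within {a..b})"
      unfolding triple_of_def by (intro has_vector_derivative_Pair segment_triple_deriv[OF P f \<gamma>[OF t]])
    \<comment> \<open>The derivative of the triple has six terms, each a constant of norm at most 4
      times a gradient entry times a coordinate. This gives the growth constant
      \<open>24 * L\<close>.\<close>
    have bound: "norm (c * grad f i (\<gamma> t) * z) \<le> 4 * L * norm (?y t)"
      if "norm c \<le> 4" "i \<in> {3, 4, 5}" "norm z \<le> norm (?y t)" for c z i
    proof -
      have "norm (grad f i (\<gamma> t)) \<le> L" using K[OF t, of i] that(2) by (auto simp: L_def)
      moreover have "0 \<le> L" by (simp add: L_def)
      ultimately show ?thesis unfolding norm_mult using that by (intro mult_mono) auto
    qed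
    have y: "norm (E' (\<gamma> t)) \<le> norm (?y t)" "norm (F' (\<gamma> t)) \<le> norm (?y t)" "norm (H' (\<gamma> t)) \<le> norm (?y t)"
      unfolding triple_of_def by (rule norm_triple_ge)+
    have "norm (?y' t) \<le> (4 * L * norm (?y t) + 4 * L * norm (?y t)) +
        (4 * L * norm (?y t) + 4 * L * norm (?y t)) + (4 * L * norm (?y t) + 4 * L * norm (?y t))"
      by (intro order_trans[OF norm_triple_le] add_mono order_trans[OF norm_triangle_ineq]
          order_trans[OF norm_triangle_ineq4] bound y) auto
    thus "norm (?y' t) \<le> (24 * L) * norm (?y t)" by simp
  qed (simp add: ends assms(3) zero_prod_def)
  thus ?thesis by (simp add: ends zero_prod_def)
qed

text \<open>After substituting the linear equations for the triple, all terms in the derivative of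
  the Casimir element cancel.\<close>

lemma segment_casimir:
  assumes P: "necklace_poisson P" and "hamiltonian_segment P \<rho> \<sigma>"
  shows "casimir \<rho> = casimir \<sigma>"
proof -
  from assms(2) obtain f \<gamma> a b where f: "f \<in> regular" and ab: "a \<le> b"
    and \<gamma>: "\<And>t. t \<in> {a..b} \<Longrightarrow> (\<gamma> has_vector_derivative hamiltonian_field P f (\<gamma> t)) (at t within {a..b})"
    and ends: "\<gamma> a = \<rho>" "\<gamma> b = \<sigma>"
    unfolding hamiltonian_segment_def by blast
  have "((\<lambda>t. casimir (\<gamma> t)) has_vector_derivative 0) (at t within {a..b})" if "t \<in> {a..b}" for t
    unfolding casimir_def power2_eq_square
    by (rule derivative_eq_intros segment_triple_deriv[OF P f \<gamma>[OF that]] refl)+ (simp add: algebra_simps)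
  then obtain c where "\<And>t. t \<in> {a..b} \<Longrightarrow> casimir (\<gamma> t) = c"
    using has_vector_derivative_zero_constant[of "{a..b}" "\<lambda>t. casimir (\<gamma> t)"] by auto
  from this[of a] this[of b] show ?thesis using ab ends by simp
qed

lemma segment_same_orbit:
  assumes P: "necklace_poisson P" and seg: "hamiltonian_segment P \<rho> \<sigma>"
  shows "same_orbit (triple_of \<rho>) (triple_of \<sigma>)"
proof -
  \<comment> \<open>\<open>segment_zero\<close> propagates vanishing forward in time only; reversing
    the segment gives the converse.\<close>
  have "triple_of \<rho> = (0, 0, 0) \<longleftrightarrow> triple_of \<sigma> = (0, 0, 0)"
    using segment_zero[OF P] hamiltonian_segment_sym[OF P] seg by blast
  thus ?thesis
    using segment_casimir[OF assms] by (simp add: same_orbit_def triple_of_def casimir_def)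
qed

section \<open>Explicit flows\<close>

lemma has_vector_derivative_vecI:
  fixes \<gamma> :: "real \<Rightarrow> 'a::real_normed_vector^'n"
  assumes "\<And>i. ((\<lambda>t. \<gamma> t $ i) has_vector_derivative v $ i) (at t within S)"
  shows "(\<gamma> has_vector_derivative v) (at t within S)"
  unfolding has_vector_derivative_def has_derivative_within
proof (intro conjI bounded_linear_scaleR_left vec_tendstoI)
  fix i
  show "((\<lambda>y. ((1 / norm (y - t)) *\<^sub>R (\<gamma> y - (\<gamma> t + (y - t) *\<^sub>R v))) $ i) \<longlongrightarrow> 0 $ i) (at t within S)"
    using assms[of i] unfolding has_vector_derivative_def has_derivative_within by simp
qed

text \<open>The five derivative hypotheses are Hamilton's equations in the coordinates of
  \<open>iss_pt\<close>, in complex time. Restricting time to the real interval from 0 to 1 yields a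
  segment.\<close>

lemma flow_segment:
  assumes P: "necklace_poisson P" and k: "k \<in> regular"
    and \<gamma>_def: "\<gamma> = (\<lambda>z. iss_pt (x z) (y z) (e z, f z, h z))"
    and x: "\<And>z. (x has_field_derivative (2 * grad k 1 (\<gamma> z) - 2 * y z * grad k 3 (\<gamma> z) + x z * grad k 5 (\<gamma> z))) (at z)"
    and y: "\<And>z. (y has_field_derivative (2 * grad k 2 (\<gamma> z) + 2 * x z * grad k 4 (\<gamma> z) - y z * grad k 5 (\<gamma> z))) (at z)"
    and e: "\<And>z. (e has_field_derivative (2 * h z * grad k 3 (\<gamma> z) + 2 * e z * grad k 5 (\<gamma> z))) (at z)"
    and f: "\<And>z. (f has_field_derivative (2 * h z * grad k 4 (\<gamma> z) - 2 * f z * grad k 5 (\<gamma> z))) (at z)"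
    and h: "\<And>z. (h has_field_derivative (- 4 * f z * grad k 3 (\<gamma> z) - 4 * e z * grad k 4 (\<gamma> z))) (at z)"
    and ends: "\<gamma> 0 = \<rho>" "\<gamma> 1 = \<sigma>"
  shows "hamiltonian_segment P \<rho> \<sigma>"
proof -
  have c: "\<gamma> z $ 1 = - y z" "\<gamma> z $ 2 = x z" "\<gamma> z $ 3 = y z * y z / 2 - 2 * f z"
    "\<gamma> z $ 4 = x z * x z / 2 + 2 * e z" "\<gamma> z $ 5 = h z - x z * y z / 2" for z
    by (simp_all add: \<gamma>_def iss_pt_def)
  have "((\<lambda>z. \<gamma> z $ i) has_field_derivative hamiltonian_field P k (\<gamma> z) $ i) (at z)" for i z
  proof -
    have "\<forall>i. ((\<lambda>z. \<gamma> z $ i) has_field_derivative hamiltonian_field P k (\<gamma> z) $ i) (at z)"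
      unfolding forall_5 field_coords[OF P k] c
      by (intro conjI DERIV_cong[OF DERIV_minus[OF y]] DERIV_cong[OF x]
          DERIV_cong[OF DERIV_diff[OF DERIV_cdivide[OF DERIV_mult[OF y y]] DERIV_cmult[OF f]]]
          DERIV_cong[OF DERIV_add[OF DERIV_cdivide[OF DERIV_mult[OF x x]] DERIV_cmult[OF e]]]
          DERIV_cong[OF DERIV_diff[OF h DERIV_cdivide[OF DERIV_mult[OF x y]]]])
        (simp_all add: field_simps)
    thus ?thesis by blast
  qed
  hence "((\<lambda>t. \<gamma> (of_real t)) has_vector_derivative hamiltonian_field P k (\<gamma> (of_real t))) (at t within {0..1})" for t
    by (intro has_vector_derivative_vecI has_vector_derivative_real_field)
  thus ?thesis
    unfolding hamiltonian_segment_def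
    by (intro bexI[OF _ k] exI[of _ "\<lambda>t. \<gamma> (of_real t)"] exI[of _ 0] exI[of _ 1]) (simp add: ends)
qed

text \<open>A quadratic Hamiltonian general enough to contain all the multiples of \<open>X\<close>, \<open>Y\<close>, \<open>E'\<close>,
  \<open>F'\<close>, \<open>H'\<close>.\<close>

definition quad :: "complex \<Rightarrow> complex \<Rightarrow> complex \<Rightarrow> complex \<Rightarrow> complex \<Rightarrow> complex^5 \<Rightarrow> complex" where
  "quad p q u v w \<rho> = p * \<rho>$1 + (q * \<rho>$2 + (u * (\<rho>$3 + (- 1/2) * (\<rho>$1 * \<rho>$1)) +
     (v * (\<rho>$4 + (- 1/2) * (\<rho>$2 * \<rho>$2)) + w * (\<rho>$5 + (- 1/2) * (\<rho>$1 * \<rho>$2)))))"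

lemma quad_regular: "quad p q u v w \<in> regular"
  unfolding quad_def[abs_def] by (intro regular.intros)

lemma grad_quad:
  "grad (quad p q u v w) 1 \<rho> = p - u * \<rho>$1 - w * \<rho>$2 / 2"
  "grad (quad p q u v w) 2 \<rho> = q - v * \<rho>$2 - w * \<rho>$1 / 2"
  "grad (quad p q u v w) 3 \<rho> = u"
  "grad (quad p q u v w) 4 \<rho> = v"
  "grad (quad p q u v w) 5 \<rho> = w"
  unfolding quad_def[abs_def]
  by (simp_all only: grad_add grad_mult grad_const grad_coord regular.intros) simp_all

text \<open>The Hamiltonian is \<open>- (x / 2) * Y\<close>, which moves \<open>X\<close> at
  constant speed \<open>x\<close> and fixes the other coordinates.\<close>

lemma leaf_shift_X:
  assumes "necklace_poisson P"
  shows "hamiltonian_segment P (iss_pt 0 y (e, f, h)) (iss_pt x y (e, f, h))"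
  by (rule flow_segment[where x="\<lambda>z. z * x" and y="\<lambda>_. y" and e="\<lambda>_. e" and f="\<lambda>_. f" and h="\<lambda>_. h",
      OF assms quad_regular[of "x / 2" 0 0 0 0] refl])
    (auto simp: grad_quad iss_pt_def intro!: derivative_eq_intros)

lemma leaf_shift_Y:
  assumes "necklace_poisson P"
  shows "hamiltonian_segment P (iss_pt x 0 (e, f, h)) (iss_pt x y (e, f, h))"
  by (rule flow_segment[where x="\<lambda>_. x" and y="\<lambda>z. z * y" and e="\<lambda>_. e" and f="\<lambda>_. f" and h="\<lambda>_. h",
      OF assms quad_regular[of 0 "y / 2" 0 0 0] refl])
    (auto simp: grad_quad iss_pt_def intro!: derivative_eq_intros)

text \<open>Time-one flow of \<open>s * E'\<close>: the fourth coefficient of \<open>quad\<close>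
  multiplies \<open>2 * E'\<close>, hence \<open>s / 2\<close>. For the F-flow below the third one
  multiplies \<open>- 2 * F'\<close>, hence \<open>- s / 2\<close>.\<close>

lemma leaf_flow_E:
  assumes "necklace_poisson P"
  shows "hamiltonian_segment P (iss_pt 0 0 (e, f, h)) (iss_pt 0 0 (e, f + s * h - s\<^sup>2 * e, h - 2 * s * e))"
  by (rule flow_segment[where x="\<lambda>_. 0" and y="\<lambda>_. 0" and e="\<lambda>_. e"
      and f="\<lambda>z. f + s * z * h - (s * z) * (s * z) * e" and h="\<lambda>z. h - 2 * (s * z) * e",
      OF assms quad_regular[of 0 0 0 "s / 2" 0] refl])
    (auto simp: grad_quad iss_pt_def power2_eq_square algebra_simps intro!: derivative_eq_intros)

lemma leaf_flow_F:
  assumes "necklace_poisson P"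
  shows "hamiltonian_segment P (iss_pt 0 0 (e, f, h)) (iss_pt 0 0 (e - s * h - s\<^sup>2 * f, f, h + 2 * s * f))"
  by (rule flow_segment[where x="\<lambda>_. 0" and y="\<lambda>_. 0" and f="\<lambda>_. f"
      and e="\<lambda>z. e - s * z * h - (s * z) * (s * z) * f" and h="\<lambda>z. h + 2 * (s * z) * f",
      OF assms quad_regular[of 0 0 "- s / 2" 0 0] refl])
    (auto simp: grad_quad iss_pt_def power2_eq_square algebra_simps intro!: derivative_eq_intros)

lemma leaf_torus:
  assumes "necklace_poisson P" "r \<noteq> 0"
  shows "hamiltonian_segment P (iss_pt 0 0 (e, f, h)) (iss_pt 0 0 (r * e, f / r, h))"
proof -
  \<comment> \<open>The Hamiltonian \<open>(c / 2) * H'\<close> scales \<open>E'\<close> by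
    \<open>exp c\<close> at time one, so \<open>c\<close> must be a logarithm of
    \<open>r\<close>.\<close>
  define c where "c = Ln r"
  have r: "exp c = r" "exp (- c) = 1 / r"
    using assms(2) by (simp_all add: c_def exp_minus divide_inverse)
  have D: "((\<lambda>z. exp (c * z) * a) has_field_derivative c * exp (c * z) * a) (at z)" for a c z :: complex
    by (auto intro!: derivative_eq_intros)
  show ?thesis
    by (rule flow_segment[where x="\<lambda>_. 0" and y="\<lambda>_. 0" and e="\<lambda>z. exp (c * z) * e"
          and f="\<lambda>z. exp (- c * z) * f" and h="\<lambda>_. h", OF assms(1) quad_regular[of 0 0 0 0 "c / 2"] refl];
        (intro DERIV_cong[OF DERIV_const] DERIV_cong[OF D])?; simp add: grad_quad iss_pt_nth r)
qed

text \<open>One inclusion is invariance along a chain of segments. For the other, both points are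
  moved to \<open>X = Y = 0\<close> with their triples unchanged, where the flows of
  \<open>E'\<close>, \<open>F'\<close>, \<open>H'\<close> connect all triples of one class.\<close>

lemma symplectic_leaf_eq:
  assumes P: "necklace_poisson P"
  shows "symplectic_leaf P \<rho> = {\<sigma>. same_orbit (triple_of \<rho>) (triple_of \<sigma>)}"
proof (intro equalityI subsetI CollectI)
  fix \<sigma> assume "\<sigma> \<in> symplectic_leaf P \<rho>"
  hence "(hamiltonian_segment P)\<^sup>*\<^sup>* \<rho> \<sigma>" by (simp add: symplectic_leaf_def)
  thus "same_orbit (triple_of \<rho>) (triple_of \<sigma>)"
    by induction (auto intro: same_orbit_refl same_orbit_trans segment_same_orbit[OF P])
next
  fix \<sigma> assume "\<sigma> \<in> {\<sigma>. same_orbit (triple_of \<rho>) (triple_of \<sigma>)}"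
  hence orb: "same_orbit (triple_of \<rho>) (triple_of \<sigma>)" by simp
  let ?L = "(hamiltonian_segment P)\<^sup>*\<^sup>*"
  have "symp (hamiltonian_segment P)"
    using hamiltonian_segment_sym[OF P] by (rule sympI)
  hence sym: "?L \<tau> \<rho>" if "?L \<rho> \<tau>" for \<rho> \<tau>
    using that by (rule sympD[OF symp_rtranclp])
  have origin: "?L (iss_pt 0 0 (triple_of \<tau>)) \<tau>" for \<tau>
  proof -
    obtain e f h where t: "triple_of \<tau> = (e, f, h)" by (metis prod_cases3)
    show ?thesis
      using leaf_shift_X[OF P, of 0 e f h "\<tau>$2"] leaf_shift_Y[OF P, of "\<tau>$2" e f h "- \<tau>$1"]
        iss_pt_triple_of[of \<tau>] unfolding t by (metis r_into_rtranclp rtranclp_trans)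
  qed
  have "?L (iss_pt 0 0 (triple_of \<rho>)) (iss_pt 0 0 (triple_of \<sigma>))"
  proof (rule same_orbit_connected[OF _ _ _ _ _ _ orb, of "\<lambda>s t. ?L (iss_pt 0 0 s) (iss_pt 0 0 t)"])
    show "?L (iss_pt 0 0 s) (iss_pt 0 0 u)"
      if "?L (iss_pt 0 0 s) (iss_pt 0 0 t)" "?L (iss_pt 0 0 t) (iss_pt 0 0 u)" for s t u
      using that by (rule rtranclp_trans)
    show "?L (iss_pt 0 0 t) (iss_pt 0 0 s)" if "?L (iss_pt 0 0 s) (iss_pt 0 0 t)" for s t
      using that by (rule sym)
  qed (simp, (intro r_into_rtranclp leaf_flow_E[OF P] leaf_flow_F[OF P] leaf_torus[OF P]; assumption?)+)
  thus "\<sigma> \<in> symplectic_leaf P \<rho>"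
    unfolding symplectic_leaf_def
    using rtranclp_trans[OF sym[OF origin[of \<rho>]]] rtranclp_trans[OF _ origin[of \<sigma>]] by blast
qed

section \<open>Matching of leaves, coadjoint orbits and level sets\<close>

theorem theorem7:
  fixes P :: "(complex^5 \<Rightarrow> complex) \<Rightarrow> (complex^5 \<Rightarrow> complex) \<Rightarrow> (complex^5 \<Rightarrow> complex)"
  assumes "necklace_poisson P"
  shows "bij_betw (\<lambda>orb. sl2_map -` orb) coadjoint_orbits (symplectic_leaves P) \<and>
    symplectic_leaves P = {level_set l | l. l \<noteq> 0} \<union> {S0', S0''}"
proof
  define leaf where "leaf t = {\<sigma>. same_orbit t (triple_of \<sigma>)}" for t
  have surj: "range triple_of = UNIV"
    using triple_of_iss_pt by (rule surjI)
  have "symplectic_leaves P = leaf ` range triple_of"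
    unfolding symplectic_leaves_def symplectic_leaf_eq[OF assms] leaf_def image_image ..
  hence leaves: "symplectic_leaves P = range leaf"
    unfolding surj .
  have orbits: "coadjoint_orbits = range (\<lambda>s. dual_point ` {t. same_orbit s t})"
    by (simp add: coadjoint_orbits_def sl2_dual_eq image_image coadjoint_orbit_dual_point)
  have preimage: "sl2_map -` (dual_point ` T) = triple_of -` T" for T
    by (auto simp: sl2_map_eq dual_point_inject)
  \<comment> \<open>Since \<open>triple_of\<close> is surjective, a set of triples is recovered from
    its preimage; distinct orbits therefore have distinct preimages.\<close>
  have inject: "T = T'" if "triple_of -` T = triple_of -` T'" for T T'
    using that surj by (metis surj_image_vimage_eq)
  have "inj_on (\<lambda>orb. sl2_map -` orb) coadjoint_orbits"
    unfolding orbits by (rule inj_onI) (metis (no_types, lifting) preimage inject imageE)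
  moreover have "(\<lambda>orb. sl2_map -` orb) ` coadjoint_orbits = symplectic_leaves P"
    by (simp add: orbits leaves image_image preimage) (simp add: leaf_def vimage_def)
  ultimately show "bij_betw (\<lambda>orb. sl2_map -` orb) coadjoint_orbits (symplectic_leaves P)"
    by (simp add: bij_betw_def)
  show "symplectic_leaves P = {level_set l | l. l \<noteq> 0} \<union> {S0', S0''}"
  proof (intro equalityI subsetI)
    fix S assume "S \<in> symplectic_leaves P"
    then obtain e f h where S: "S = leaf (e, f, h)" unfolding leaves by auto
    define l where "l = h\<^sup>2 + 4 * e * f"
    \<comment> \<open>A nonzero Casimir value excludes the zero triple; only the zero level splits
      into two classes.\<close>
    consider "l \<noteq> 0" | "l = 0" "(e, f, h) \<noteq> (0, 0, 0)" | "(e, f, h) = (0, 0, 0)" by blast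
    thus "S \<in> {level_set l | l. l \<noteq> 0} \<union> {S0', S0''}"
    proof cases
      case 1
      hence "S = level_set l"
        by (auto simp: S leaf_def same_orbit_def triple_of_def level_set_def casimir_def l_def)
      thus ?thesis using 1 by blast
    next
      case 2
      hence "S = S0'"
        by (auto simp: S leaf_def same_orbit_def triple_of_def S0'_def casimir_def l_def)
      thus ?thesis by blast
    next
      case 3
      hence "S = S0''"
        by (auto simp: S leaf_def same_orbit_def triple_of_def S0''_def)
      thus ?thesis by blast
    qed
  next
    fix S assume "S \<in> {level_set l | l. l \<noteq> 0} \<union> {S0', S0''}"
    then consider l where "l \<noteq> 0" "S = level_set l" | "S = S0'" | "S = S0''" by blast
    thus "S \<in> symplectic_leaves P"
    proof cases
      case (1 l)
      \<comment> \<open>The normal form with Casimir value \<open>l\<close> represents the class;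
        for \<open>l = 0\<close> it becomes \<open>(1, 0, 0)\<close>.\<close>
      hence "S = leaf (1, l / 4, 0)"
        by (auto simp: leaf_def same_orbit_def triple_of_def level_set_def casimir_def)
      thus ?thesis by (simp add: leaves)
    next
      case 2
      hence "S = leaf (1, 0, 0)"
        by (auto simp: leaf_def same_orbit_def triple_of_def S0'_def casimir_def)
      thus ?thesis by (simp add: leaves)
    next
      case 3
      hence "S = leaf (0, 0, 0)"
        by (auto simp: leaf_def same_orbit_def triple_of_def S0''_def)
      thus ?thesis by (simp add: leaves)
    qed
  qed
qed

end
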